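(* Let $n,D\in\mathbb{Z}$ with $n>0$, and let $p\neq 2$ be a prime with $p\mid D$ and $\nu_p(D)<n$. Then, as $\nu_p(D)\to\infty$, $$L_p(n,D)\sim\frac{1}{8\,\nu_p(D)}\exp\!\left(\pi\sqrt{\nu_p(D)}\right).$$
   Context: $L_p(n,D)$ denotes the number of valid $p$-adic genus symbols (in the sense of Conway–Sloane) of rank $n$ and determinant $D$, i.e. the number of isometry classes of nondegenerate integral $\mathbb{Z}_p$-lattices of rank $n$ whose determinant equals $D$ modulo squares of $p$-adic units. For odd $p$ such a symbol consists of Jordan constituents $(p^i)^{\varepsilon_i d_i}$, $i\ge0$, with dimensions $d_i\ge 0$ summing to $n$, $\sum_i i\,d_i=\nu_p(D)$, and signs $\varepsilon_i\in\{\pm1\}$ (Legendre symbol of the unit part of the constituent's determinant) for nonzero constituents, subject to the determinant condition. $\nu_p(D)$ is the $p$-adic valuation of $D$. *)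

theory Defs
  imports
    Complex_Main
    "HOL-Library.Landau_Symbols"
    "HOL-Number_Theory.Number_Theory"
begin

text \<open>
  A symbol is a pair \<open>(d, \<epsilon>)\<close>, where \<open>d i\<close> and \<open>\<epsilon> i\<close> are the dimension and the sign of the
  Jordan constituent at scale \<open>p ^ i\<close>.  Absent constituents carry the sign \<open>1\<close> by convention,
  so that distinct pairs are distinct symbols.  The last conjunct is the determinant condition:
  the unit parts of the determinants of the constituents multiply to the unit part of \<open>D\<close>
  modulo squares of \<open>p\<close>-adic units.  The description is the one for odd primes \<open>p\<close>; for \<open>D = 0\<close>
  there are no symbols, since then the Legendre symbol is \<open>0\<close>.
\<close>

definition genus_symbol ::
    "int \<Rightarrow> nat \<Rightarrow> int \<Rightarrow> (nat \<Rightarrow> nat) \<times> (nat \<Rightarrow> int) \<Rightarrow> bool" where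
  "genus_symbol p n D = (\<lambda>(d, \<epsilon>).
     finite {i. d i \<noteq> 0} \<and>
     (\<forall>i. d i \<noteq> 0 \<longrightarrow> \<epsilon> i \<in> {1, -1}) \<and>
     (\<forall>i. d i = 0 \<longrightarrow> \<epsilon> i = 1) \<and>
     (\<Sum>i | d i \<noteq> 0. d i) = n \<and>
     (\<Sum>i | d i \<noteq> 0. i * d i) = multiplicity p D \<and>
     (\<Prod>i | d i \<noteq> 0. \<epsilon> i) = Legendre (D div p ^ multiplicity p D) p)"

definition num_genus_symbols :: "int \<Rightarrow> nat \<Rightarrow> int \<Rightarrow> nat" where
  "num_genus_symbols p n D = card {s. genus_symbol p n D s}"

lemma finite_genus_symbols: "finite {s. genus_symbol p n D s}"
proof -
  define m where "m = multiplicity p D"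
  define A where "A = {d :: nat \<Rightarrow> nat. \<forall>i. (i \<in> {..m} \<longrightarrow> d i \<in> {..n}) \<and> (i \<notin> {..m} \<longrightarrow> d i = 0)}"
  define B where "B = {e :: nat \<Rightarrow> int. \<forall>i. (i \<in> {..m} \<longrightarrow> e i \<in> {1, -1}) \<and> (i \<notin> {..m} \<longrightarrow> e i = 1)}"
  have "finite A" "finite B"
    unfolding A_def B_def by (rule finite_set_of_finite_funs; simp; fail)+
  moreover have "{s. genus_symbol p n D s} \<subseteq> A \<times> B"
  proof safe
    fix d e assume s: "genus_symbol p n D (d, e)"
    have fin: "finite {i. d i \<noteq> 0}" and sn: "(\<Sum>i | d i \<noteq> 0. d i) = n"
      and sm: "(\<Sum>i | d i \<noteq> 0. i * d i) = m"
      and e: "\<And>i. d i \<noteq> 0 \<Longrightarrow> e i \<in> {1, -1}" "\<And>i. d i = 0 \<Longrightarrow> e i = 1"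
      using s by (auto simp: genus_symbol_def m_def)
    have dn: "d i \<le> n" for i
      using member_le_sum[of i "{i. d i \<noteq> 0}" d] fin sn by (cases "d i = 0") auto
    have dm: "d i = 0" if "i > m" for i
    proof (rule ccontr)
      assume "d i \<noteq> 0"
      then have "i * d i \<le> m"
        using member_le_sum[of i "{i. d i \<noteq> 0}" "\<lambda>i. i * d i"] fin sm by auto
      moreover have "i * 1 \<le> i * d i"
        using \<open>d i \<noteq> 0\<close> by (intro mult_le_mono) auto
      ultimately show False using that by simp
    qed
    show "d \<in> A" using dn dm by (auto simp: A_def)
    have "e i \<in> {1, -1}" for i
      using e[of i] by (cases "d i = 0") auto
    moreover have "e i = 1" if "i > m" for i
      using e(2) dm that by simp
    ultimately show "e \<in> B" by (simp add: B_def)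
  qed
  ultimately show ?thesis by (meson finite_SigmaI finite_subset)
qed

end

theory Submission
  imports Defs "HOL-Probability.Probability" "HOL-Real_Asymp.Real_Asymp"
begin

text \<open>
  Put \<open>m = multiplicity p D\<close>.  Since \<open>m < n\<close>, the unimodular constituent is never zero, so its dimension
  and its sign are determined by the other constituents; what remains is an overpartition of \<open>m\<close>.

  The generating function of overpartitions is \<open>\<Prod>k\<ge>1. (1 + q ^ k) / (1 - q ^ k) = exp (log_gf z)\<close> with
  \<open>q = exp (- z)\<close>, and the coefficients are extracted by the saddle point method on the circle of radius
  \<open>exp (- s)\<close>, \<open>s = pi / (2 * sqrt m)\<close>.  Two facts are needed.

  On the real axis \<open>log_gf s = pi\<^sup>2 / (4 * s) + ln s / 2 - ln 2 - ln pi / 2 + o(1)\<close>.  No modularity is used: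
  \<open>log_gf s - 2 * log_gf (2 * s)\<close> is an alternating sum of a convex function with a logarithmic
  singularity, which Wallis' product evaluates up to \<open>o(1)\<close>, and an error term \<open>U\<close> with \<open>U s - 2 * U (2 * s)\<close>
  and \<open>s * U s\<close> tending to \<open>0\<close> tends to \<open>0\<close> itself.

  On the circle \<open>log_gf z - pi\<^sup>2 / (4 * z)\<close> varies by \<open>o(1)\<close> at distance \<open>O(s powr (3/2))\<close> from \<open>s\<close>, and
  the first term of the series for \<open>log_gf\<close> alone makes the integrand small away from \<open>s\<close>.
  Dominated convergence then leaves a Gaussian integral.
\<close>

text \<open>The radius minimises \<open>pi\<^sup>2 / (4 * s) + m * s\<close>, with minimum
  \<open>pi * sqrt m\<close>. The second derivative of the first summand is of order
  \<open>1 / s ^ 3\<close>, which explains the width \<open>s powr (3/2)\<close>: with the angle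
  written as \<open>s powr (3/2) * t\<close> the integrand tends to a Gaussian of mass
  \<open>2 / sqrt pi\<close>. The prefactor is the product of \<open>s powr (3/2) / (2 * pi)\<close>
  from the change of variable, this mass, and \<open>sqrt s / (2 * sqrt pi)\<close> from the
  expansion of \<open>log_gf\<close>, which is
  \<open>s\<^sup>2 / (2 * pi\<^sup>2) = 1 / (8 * m)\<close>. The condition on \<open>s * U s\<close>
  is essential: the relation between \<open>s\<close> and \<open>2 * s\<close> cannot see a multiple
  of \<open>1 / s\<close>, so the leading order must be found separately, from the series over odd
  \<open>m\<close>. Only the real axis needs an exact constant. Near the saddle it is enough to
  compare \<open>log_gf z\<close> with \<open>log_gf s\<close>, and after removal of the pole at 0
  each term of the series changes little between the two points.\<close>

section \<open>Overpartitions\<close>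

text \<open>
  A function \<open>b\<close> encodes the overpartition in which \<open>i\<close> occurs \<open>\<bar>b i\<bar>\<close> times and is overlined iff \<open>b i < 0\<close>.
\<close>

definition signed_partitions :: "nat \<Rightarrow> nat \<Rightarrow> (nat \<Rightarrow> int) set" where
  "signed_partitions M m =
     {b. (\<forall>i. i \<notin> {1..M} \<longrightarrow> b i = 0) \<and> (\<Sum>i=1..M. i * nat \<bar>b i\<bar>) = m}"

lemma signed_partitions_le:
  assumes "b \<in> signed_partitions M m"
  shows "i * nat \<bar>b i\<bar> \<le> m"
proof (cases "i \<in> {1..M}")
  case True
  then have "i * nat \<bar>b i\<bar> \<le> (\<Sum>i=1..M. i * nat \<bar>b i\<bar>)"
    by (intro member_le_sum[of i "{1..M}" "\<lambda>i. i * nat \<bar>b i\<bar>"]) auto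
  then show ?thesis using assms by (simp add: signed_partitions_def)
next
  case False
  then show ?thesis using assms by (simp add: signed_partitions_def)
qed

lemma signed_partitions_eq_0:
  assumes "b \<in> signed_partitions M m" "i > m"
  shows "b i = 0"
proof (rule ccontr)
  assume "b i \<noteq> 0"
  then have "i * 1 \<le> i * nat \<bar>b i\<bar>"
    by (intro mult_le_mono) auto
  then have "i \<le> i * nat \<bar>b i\<bar>" by simp
  then show False using signed_partitions_le[OF assms(1), of i] assms(2) by linarith
qed

lemma finite_signed_partitions: "finite (signed_partitions M m)"
proof -
  have "signed_partitions M m \<subseteq>
      {b. \<forall>i. (i \<in> {1..M} \<longrightarrow> b i \<in> {- int m..int m}) \<and> (i \<notin> {1..M} \<longrightarrow> b i = 0)}"
  proof
    fix b assume b: "b \<in> signed_partitions M m"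
    have "b i \<in> {- int m..int m}" if "i \<in> {1..M}" for i
    proof -
      have "1 * nat \<bar>b i\<bar> \<le> i * nat \<bar>b i\<bar>" using that by (intro mult_le_mono) auto
      also have "\<dots> \<le> m" by (rule signed_partitions_le[OF b])
      finally show ?thesis by auto
    qed
    then show "b \<in> {b. \<forall>i. (i \<in> {1..M} \<longrightarrow> b i \<in> {- int m..int m}) \<and> (i \<notin> {1..M} \<longrightarrow> b i = 0)}"
      using b by (auto simp: signed_partitions_def)
  qed
  then show ?thesis
    by (rule finite_subset) (rule finite_set_of_finite_funs; simp)
qed

lemma sum_extend_support:
  fixes b :: "nat \<Rightarrow> int"
  assumes "\<forall>i. i \<notin> {1..K} \<longrightarrow> b i = 0" "K \<le> M"
  shows "(\<Sum>i=1..M. i * nat \<bar>b i\<bar>) = (\<Sum>i=1..K. i * nat \<bar>b i\<bar>)"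
  using assms by (intro sum.mono_neutral_right) auto

lemma signed_partitions_mono: "K \<le> M \<Longrightarrow> signed_partitions K m \<subseteq> signed_partitions M m"
  using sum_extend_support[of K _ M] by (auto simp: signed_partitions_def)

text \<open>A part larger than the total cannot occur. This makes each coefficient of the finite
  products eventually constant in \<open>M\<close>.\<close>

lemma signed_partitions_stable:
  assumes "m \<le> M"
  shows "signed_partitions M m = signed_partitions m m"
proof
  show "signed_partitions m m \<subseteq> signed_partitions M m"
    by (rule signed_partitions_mono[OF assms])
  show "signed_partitions M m \<subseteq> signed_partitions m m"
  proof
    fix b assume b: "b \<in> signed_partitions M m"
    have *: "\<forall>i. i \<notin> {1..m} \<longrightarrow> b i = 0"
      using signed_partitions_eq_0[OF b] b assms by (auto simp: signed_partitions_def not_le)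
    then show "b \<in> signed_partitions m m"
      using sum_extend_support[OF * assms] b by (auto simp: signed_partitions_def)
  qed
qed

lemma signed_partitions_0: "signed_partitions 0 m = (if m = 0 then {\<lambda>_. 0} else {})"
  by (auto simp: signed_partitions_def)

lemma finite_int_abs_mult_eq:
  assumes "k > 0" shows "finite {x::int. k * nat \<bar>x\<bar> = i}"
proof (rule finite_subset)
  show "{x::int. k * nat \<bar>x\<bar> = i} \<subseteq> {- int i..int i}"
  proof safe
    fix x :: int
    have "1 * nat \<bar>x\<bar> \<le> k * nat \<bar>x\<bar>" using assms by (intro mult_le_mono) auto
    then have "\<bar>x\<bar> \<le> int (k * nat \<bar>x\<bar>)" by linarith
    then show "x \<in> {- int (k * nat \<bar>x\<bar>)..int (k * nat \<bar>x\<bar>)}"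
      by (metis abs_le_D1 abs_le_D2 atLeastAtMost_iff minus_le_iff)
  qed
qed simp

text \<open>Splitting off the value at \<open>Suc M\<close> leaves an encoding with parts up to
  \<open>M\<close>. The formula is the Cauchy product that adjoins the factor of
  \<open>k = Suc M\<close> to the finite product.\<close>

lemma card_signed_partitions_Suc:
  "card (signed_partitions (Suc M) m) =
     (\<Sum>i\<le>m. card {x::int. Suc M * nat \<bar>x\<bar> = i} * card (signed_partitions M (m - i)))"
proof -
  define T where "T i = {x::int. Suc M * nat \<bar>x\<bar> = i} \<times> signed_partitions M (m - i)" for i
  have inj: "inj_on (\<lambda>(x, b). b(Suc M := x)) (\<Union>i\<le>m. T i)"
  proof (rule inj_onI)
    fix u v
    assume uv: "u \<in> (\<Union>i\<le>m. T i)" "v \<in> (\<Union>i\<le>m. T i)"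
      and eq': "(case u of (x, b) \<Rightarrow> b(Suc M := x)) = (case v of (x, b) \<Rightarrow> b(Suc M := x))"
    obtain x b y c where u: "u = (x, b)" and v: "v = (y, c)" by (cases u, cases v)
    have eq: "b(Suc M := x) = c(Suc M := y)" using eq' by (simp add: u v)
    note * = uv[unfolded u v]
    have "b (Suc M) = 0" "c (Suc M) = 0" using * by (auto simp: T_def signed_partitions_def)
    then have "x = y \<and> b = c"
      using eq by (metis fun_upd_same fun_upd_triv fun_upd_upd)
    then show "u = v" by (simp add: u v)
  qed
  have img: "(\<lambda>(x, b). b(Suc M := x)) ` (\<Union>i\<le>m. T i) = signed_partitions (Suc M) m"
  proof (intro equalityI subsetI)
    fix b assume "b \<in> (\<lambda>(x, b). b(Suc M := x)) ` (\<Union>i\<le>m. T i)"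
    then obtain x c i where i: "i \<le> m" "Suc M * nat \<bar>x\<bar> = i" "c \<in> signed_partitions M (m - i)"
      and b: "b = c(Suc M := x)" by (auto simp: T_def)
    have "(\<Sum>j=1..M. j * nat \<bar>b j\<bar>) = (\<Sum>j=1..M. j * nat \<bar>c j\<bar>)"
      by (intro sum.cong) (auto simp: b)
    then have "(\<Sum>j=1..Suc M. j * nat \<bar>b j\<bar>) = m"
      using i by (simp add: b signed_partitions_def)
    then show "b \<in> signed_partitions (Suc M) m"
      using i by (auto simp: signed_partitions_def b)
  next
    fix b assume b: "b \<in> signed_partitions (Suc M) m"
    define c where "c = b(Suc M := 0)"
    define i where "i = Suc M * nat \<bar>b (Suc M)\<bar>"
    have "(\<Sum>j=1..M. j * nat \<bar>c j\<bar>) = (\<Sum>j=1..M. j * nat \<bar>b j\<bar>)"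
      by (intro sum.cong) (auto simp: c_def)
    moreover have "(\<Sum>j=1..M. j * nat \<bar>b j\<bar>) + i = m"
      using b by (simp add: signed_partitions_def i_def)
    ultimately have "c \<in> signed_partitions M (m - i)" "i \<le> m"
      using b by (auto simp: signed_partitions_def c_def)
    then have "(b (Suc M), c) \<in> (\<Union>i\<le>m. T i)" by (auto simp: T_def i_def)
    moreover have "b = c(Suc M := b (Suc M))" by (simp add: c_def)
    ultimately show "b \<in> (\<lambda>(x, b). b(Suc M := x)) ` (\<Union>i\<le>m. T i)" by force
  qed
  have "card (signed_partitions (Suc M) m) = card (\<Union>i\<le>m. T i)"
    using card_image[OF inj] img by simp
  also have "\<dots> = (\<Sum>i\<le>m. card (T i))"
  proof (rule card_UN_disjoint)
    show "\<forall>i\<in>{..m}. finite (T i)"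
      unfolding T_def using finite_signed_partitions finite_int_abs_mult_eq[of "Suc M"]
      by (intro ballI finite_cartesian_product) auto
    show "\<forall>i\<in>{..m}. \<forall>j\<in>{..m}. i \<noteq> j \<longrightarrow> T i \<inter> T j = {}"
      by (auto simp: T_def)
  qed simp
  finally show ?thesis by (simp add: T_def card_cartesian_product)
qed

text \<open>By \<open>signed_partitions_stable\<close> the bound \<open>m\<close> on the parts
  excludes no overpartition of \<open>m\<close>.\<close>

definition overpartitions :: "nat \<Rightarrow> nat" where
  "overpartitions m = card (signed_partitions m m)"

lemma card_signed_partitions_le: "card (signed_partitions M m) \<le> overpartitions m"
proof (cases "m \<le> M")
  case True
  from signed_partitions_stable[OF this] show ?thesis by (simp add: overpartitions_def)
next
  case False
  then show ?thesis unfolding overpartitions_def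
    by (intro card_mono finite_signed_partitions signed_partitions_mono) auto
qed

lemma card_signed_partitions_eq: "m \<le> M \<Longrightarrow> card (signed_partitions M m) = overpartitions m"
  using signed_partitions_stable[of m M] by (simp add: overpartitions_def)

section \<open>Genus symbols as overpartitions\<close>

lemma Legendre_unit_part:
  fixes p D :: int
  assumes "prime p" "D \<noteq> 0"
  shows "Legendre (D div p ^ multiplicity p D) p \<in> {1, -1}"
proof -
  have "\<not> p dvd D div p ^ multiplicity p D"
    using assms by (intro multiplicity_decompose) auto
  then show ?thesis by (auto simp: Legendre_def cong_0_iff)
qed

lemma num_genus_symbols_eq_overpartitions:
  fixes p D :: int
  assumes "prime p" "D \<noteq> 0" "multiplicity p D < n"
  shows "num_genus_symbols p n D = overpartitions (multiplicity p D)"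
proof -
  define m where "m = multiplicity p D"
  define \<sigma> where "\<sigma> = Legendre (D div p ^ multiplicity p D) p"
  have \<sigma>: "\<sigma> \<in> {1, -1}" unfolding \<sigma>_def by (rule Legendre_unit_part[OF assms(1,2)])
  \<comment> \<open>The product \<open>e i * int (d i)\<close> keeps both data, since an absent
    constituent has sign \<open>1\<close> by convention. Index 0 is set to 0, as
    \<open>signed_partitions\<close> demands outside \<open>{1..m}\<close>.\<close>
  define f where "f = (\<lambda>(d::nat \<Rightarrow> nat, e::nat \<Rightarrow> int) i. if i = 0 then 0 else e i * int (d i))"
  \<comment> \<open>The rank restores the dimension at scale 0 and the determinant condition
    restores its sign; multiplying by the other signs is dividing by them, as each is its own
    inverse.\<close>
  define g where "g = (\<lambda>b::nat \<Rightarrow> int.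
    ((\<lambda>i. if i = 0 then n - (\<Sum>j=1..m. nat \<bar>b j\<bar>) else nat \<bar>b i\<bar>),
     (\<lambda>i. if i = 0 then \<sigma> * (\<Prod>j=1..m. if b j < 0 then -1 else 1) else if b i < 0 then -1 else (1::int))))"
  \<comment> \<open>Sums over the support become sums over a fixed range, with index 0 isolated. The
    clause \<open>d 0 \<noteq> 0\<close> is forced by \<open>m < n\<close>, and it leaves the sign
    at scale 0 free to meet the determinant condition.\<close>
  have gen: "genus_symbol p n D (d, e) \<longleftrightarrow>
      (\<forall>i. i > m \<longrightarrow> d i = 0) \<and> d 0 \<noteq> 0 \<and> (\<forall>i. e i \<in> {1, -1}) \<and> (\<forall>i. d i = 0 \<longrightarrow> e i = 1) \<and>
      d 0 + (\<Sum>i=1..m. d i) = n \<and> (\<Sum>i=1..m. i * d i) = m \<and> e 0 * (\<Prod>i=1..m. e i) = \<sigma>"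
    (is "?L \<longleftrightarrow> ?R") for d e
  proof -
    have split0: "{..m} = insert 0 {1..m}" by auto
    have red: "(\<Sum>i | d i \<noteq> 0. d i) = d 0 + (\<Sum>i=1..m. d i)"
         "(\<Sum>i | d i \<noteq> 0. i * d i) = (\<Sum>i=1..m. i * d i)"
         "(\<forall>i. d i = 0 \<longrightarrow> e i = 1) \<Longrightarrow> (\<Prod>i | d i \<noteq> 0. e i) = e 0 * (\<Prod>i=1..m. e i)"
      if z: "\<forall>i. i > m \<longrightarrow> d i = 0"
    proof -
      have sub: "{i. d i \<noteq> 0} \<subseteq> {..m}" using z by (auto simp: not_less[symmetric])
      have "(\<Sum>i | d i \<noteq> 0. d i) = (\<Sum>i\<in>{..m}. d i)"
        using sub by (intro sum.mono_neutral_left) auto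
      then show "(\<Sum>i | d i \<noteq> 0. d i) = d 0 + (\<Sum>i=1..m. d i)" by (simp add: split0)
      have "(\<Sum>i | d i \<noteq> 0. i * d i) = (\<Sum>i\<in>{..m}. i * d i)"
        using sub by (intro sum.mono_neutral_left) auto
      then show "(\<Sum>i | d i \<noteq> 0. i * d i) = (\<Sum>i=1..m. i * d i)" by (simp add: split0)
      assume e1: "\<forall>i. d i = 0 \<longrightarrow> e i = 1"
      have "(\<Prod>i | d i \<noteq> 0. e i) = (\<Prod>i\<in>{..m}. e i)"
        using sub e1 by (intro prod.mono_neutral_left) auto
      then show "(\<Prod>i | d i \<noteq> 0. e i) = e 0 * (\<Prod>i=1..m. e i)" by (simp add: split0)
    qed
    show ?thesis
    proof
      assume L: ?L
      have fin: "finite {i. d i \<noteq> 0}" and sn: "(\<Sum>i | d i \<noteq> 0. d i) = n"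
        and sm: "(\<Sum>i | d i \<noteq> 0. i * d i) = m"
        and e: "\<And>i. d i \<noteq> 0 \<Longrightarrow> e i \<in> {1, -1}" "\<forall>i. d i = 0 \<longrightarrow> e i = 1"
        and pe: "(\<Prod>i | d i \<noteq> 0. e i) = \<sigma>"
        using L by (auto simp: genus_symbol_def m_def \<sigma>_def)
      have z: "\<forall>i. i > m \<longrightarrow> d i = 0"
      proof (intro allI impI, rule ccontr)
        fix i assume i: "i > m" "d i \<noteq> 0"
        then have "i * d i \<le> m"
          using member_le_sum[of i "{i. d i \<noteq> 0}" "\<lambda>i. i * d i"] fin sm by auto
        moreover have "i * 1 \<le> i * d i" using i by (intro mult_le_mono) auto
        ultimately show False using i by simp
      qed
      note red = red[OF z]
      \<comment> \<open>At scales \<open>i \<ge> 1\<close> a constituent weighs at least its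
        dimension, so these dimensions add up to at most \<open>m < n\<close>.\<close>
      have "(\<Sum>i=1..m. d i) \<le> (\<Sum>i=1..m. i * d i)" by (intro sum_mono) auto
      then have "d 0 \<noteq> 0" using red sn sm assms(3) by (simp add: m_def)
      moreover have "e i \<in> {1, -1}" for i using e by (cases "d i = 0") auto
      ultimately show ?R using red e z sn sm pe by simp
    next
      assume R: ?R
      then have z: "\<forall>i. i > m \<longrightarrow> d i = 0" by blast
      have "{i. d i \<noteq> 0} \<subseteq> {..m}" using z by (auto simp: not_less[symmetric])
      then have "finite {i. d i \<noteq> 0}" by (rule finite_subset) simp
      then show ?L using R red[OF z] by (simp add: genus_symbol_def m_def \<sigma>_def)
    qed
  qed
  have "bij_betw f {s. genus_symbol p n D s} (signed_partitions m m)"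
  proof (rule bij_betwI[where g = g])
    show "f \<in> {s. genus_symbol p n D s} \<rightarrow> signed_partitions m m"
    proof (intro Pi_I, clarify)
      fix d e assume "genus_symbol p n D (d, e)"
      note R = this[unfolded gen]
      have ab: "nat \<bar>f (d, e) i\<bar> = d i" if "i \<noteq> 0" for i
      proof -
        have "e i = 1 \<or> e i = -1" using R by auto
        then show ?thesis using that by (auto simp: f_def)
      qed
      have "(\<Sum>i=1..m. i * nat \<bar>f (d, e) i\<bar>) = (\<Sum>i=1..m. i * d i)"
        by (intro sum.cong) (auto simp: ab)
      then show "f (d, e) \<in> signed_partitions m m"
        using R by (auto simp: signed_partitions_def f_def)
    qed
    show "g \<in> signed_partitions m m \<rightarrow> {s. genus_symbol p n D s}"
    proof (intro Pi_I)
      fix b assume b: "b \<in> signed_partitions m m"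
      have "(\<Sum>j=1..m. nat \<bar>b j\<bar>) \<le> (\<Sum>j=1..m. j * nat \<bar>b j\<bar>)" by (intro sum_mono) auto
      also have "\<dots> = m" using b by (simp add: signed_partitions_def)
      finally have le: "(\<Sum>j=1..m. nat \<bar>b j\<bar>) < n" using assms(3) by (simp add: m_def)
      have sq: "(\<Prod>j=1..m. if b j < 0 then -1 else 1) \<in> {1, -1::int}" for m
        by (induction m) auto
      have sq': "(\<Prod>j=1..m. if b j < 0 then -1 else 1) * (\<Prod>j=1..m. if b j < 0 then -1 else 1) = (1::int)"
        using sq[of m] by auto
      have s1: "(\<Sum>i=1..m. fst (g b) i) = (\<Sum>j=1..m. nat \<bar>b j\<bar>)"
        by (intro sum.cong) (auto simp: g_def)
      have s2: "(\<Sum>i=1..m. i * fst (g b) i) = (\<Sum>j=1..m. j * nat \<bar>b j\<bar>)"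
        by (intro sum.cong) (auto simp: g_def)
      have s3: "(\<Prod>i=1..m. snd (g b) i) = (\<Prod>j=1..m. if b j < 0 then -1 else 1)"
        by (intro prod.cong) (auto simp: g_def)
      have s4: "snd (g b) i \<in> {1, -1}" for i
        using \<sigma> sq[of m] by (auto simp: g_def)
      have "genus_symbol p n D (fst (g b), snd (g b))"
        unfolding gen s1 s2 s3
      proof (intro conjI)
        show "\<forall>i>m. fst (g b) i = 0" "(\<Sum>j=1..m. j * nat \<bar>b j\<bar>) = m"
          using b by (auto simp: g_def signed_partitions_def)
        show "fst (g b) 0 \<noteq> 0" "fst (g b) 0 + (\<Sum>j=1..m. nat \<bar>b j\<bar>) = n"
          using le by (auto simp: g_def)
        show "\<forall>i. snd (g b) i \<in> {1, -1}" using s4 by blast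
        show "\<forall>i. fst (g b) i = 0 \<longrightarrow> snd (g b) i = 1" using le by (auto simp: g_def)
        show "snd (g b) 0 * (\<Prod>j=1..m. if b j < 0 then -1 else 1) = \<sigma>"
          using sq' by (simp add: g_def mult.assoc)
      qed
      then show "g b \<in> {s. genus_symbol p n D s}" by simp
    qed
    show "g (f x) = x" if "x \<in> {s. genus_symbol p n D s}" for x
    proof -
      obtain d e where x: "x = (d, e)" by (cases x)
      have R: "genus_symbol p n D (d, e)" using that x by simp
      note R = R[unfolded gen]
      have ei: "e i = 1 \<or> e i = -1" for i using R by auto
      have ab: "nat \<bar>f (d, e) i\<bar> = d i" if "i \<noteq> 0" for i
        using that ei[of i] by (auto simp: f_def)
      have sg: "(if f (d, e) i < 0 then -1 else 1) = e i" if "i \<noteq> 0" for i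
      proof (cases "d i = 0")
        case True
        then show ?thesis using R by (simp add: f_def)
      next
        case False
        then show ?thesis using ei[of i] that by (elim disjE) (simp_all add: f_def)
      qed
      have "(\<Sum>i=1..m. nat \<bar>f (d, e) i\<bar>) = (\<Sum>i=1..m. d i)"
        by (intro sum.cong) (auto simp: ab)
      moreover have "d 0 + (\<Sum>i=1..m. d i) = n" using R by blast
      ultimately have n0: "n - (\<Sum>i=1..m. nat \<bar>f (d, e) i\<bar>) = d 0" by linarith
      have pp: "(\<Prod>i=1..m. if f (d, e) i < 0 then -1 else 1) = (\<Prod>i=1..m. e i)"
        by (intro prod.cong) (auto simp: sg)
      have sq: "(\<Prod>i=1..k. e i) \<in> {1, -1}" for k
      proof (induction k)
        case (Suc k) then show ?case using ei[of "Suc k"] by auto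
      qed simp
      have "\<sigma> * (\<Prod>i=1..m. e i) = e 0 * ((\<Prod>i=1..m. e i) * (\<Prod>i=1..m. e i))"
        using R by (metis mult.assoc)
      also have "(\<Prod>i=1..m. e i) * (\<Prod>i=1..m. e i) = 1" using sq[of m] by auto
      finally have e0: "\<sigma> * (\<Prod>i=1..m. if f (d, e) i < 0 then -1 else 1) = e 0" unfolding pp by simp
      have "fst (g (f x)) = d"
        unfolding x by (rule ext) (use n0 ab in \<open>simp add: g_def\<close>)
      moreover have "snd (g (f x)) = e"
      proof
        fix i show "snd (g (f x)) i = e i"
        proof (cases "i = 0")
          case True
          then show ?thesis using e0 unfolding x by (simp only: g_def snd_conv simp_thms if_True)
        next
          case False
          then show ?thesis using sg[OF False] unfolding x
            by (simp only: g_def snd_conv simp_thms if_False)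
        qed
      qed
      ultimately show "g (f x) = x" by (simp add: x prod_eq_iff)
    qed
    show "f (g b) = b" if "b \<in> signed_partitions m m" for b
    proof
      fix i
      have "b 0 = 0" using that by (simp add: signed_partitions_def)
      then show "f (g b) i = b i" by (simp add: f_def g_def)
    qed
  qed
  from bij_betw_same_card[OF this] show ?thesis
    by (simp add: num_genus_symbols_def overpartitions_def m_def)
qed

section \<open>The generating function\<close>

text \<open>Dominated convergence for series, with the bound asked for at all \<open>k\<close> at
  once, as the applications provide it; the general theorem asks for it along a product
  filter.\<close>

lemma tannery:
  fixes a :: "nat \<Rightarrow> 'b \<Rightarrow> 'a :: {real_normed_algebra, banach}"
  assumes "\<And>k. ((\<lambda>x. a k x) \<longlongrightarrow> b k) F"
    and "\<forall>\<^sub>F x in F. \<forall>k. norm (a k x) \<le> B k" and "summable B" and "F \<noteq> bot"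
  shows "((\<lambda>x. \<Sum>k. a k x) \<longlongrightarrow> (\<Sum>k. b k)) F"
proof -
  have "eventually (\<lambda>(k, x). norm (a k x) \<le> B k) (at_top \<times>\<^sub>F F)"
    unfolding eventually_prod_filter
    by (rule exI[of _ "\<lambda>_. True"], rule exI[of _ "\<lambda>x. \<forall>k. norm (a k x) \<le> B k"])
       (use assms(2) in auto)
  from tannerys_theorem[OF assms(1) this assms(3,4)] show ?thesis by blast
qed

text \<open>
  The double series \<open>\<Sum>k. ln ((1 + q ^ k) / (1 - q ^ k)) = \<Sum>k. \<Sum>m odd. 2 * q ^ (k * m) / m\<close>, \<open>q = exp (- z)\<close>,
  summed over \<open>k\<close> first, with \<open>m = 2 * j + 1\<close>.
\<close>

definition log_gf :: "'a \<Rightarrow> 'a :: {real_normed_field, banach}" where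
  "log_gf z = (\<Sum>j. 2 / (of_nat (2 * j + 1) * (exp (of_nat (2 * j + 1) * z) - 1)))"

lemma norm_exp_minus_1_ge:
  fixes w :: complex
  shows "exp (Re w) - 1 \<le> norm (exp w - 1)"
  using norm_triangle_ineq2[of "exp w" 1] by simp

lemma norm_log_gf_term_le:
  fixes z :: complex
  assumes "Re z > 0"
  shows "norm (2 / (of_nat (2 * j + 1) * (exp (of_nat (2 * j + 1) * z) - 1)))
           \<le> (2 / Re z) * (1 / real (Suc j) ^ 2)"
proof -
  define m where "m = real (2 * j + 1)"
  have m: "m > 0" "m \<ge> real (Suc j)" by (simp_all add: m_def)
  have "m * Re z \<le> exp (m * Re z) - 1" using exp_ge_add_one_self[of "m * Re z"] by linarith
  also have "\<dots> \<le> norm (exp (of_nat (2 * j + 1) * z) - 1)"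
    using norm_exp_minus_1_ge[of "of_nat (2 * j + 1) * z"] by (simp add: m_def)
  finally have le: "m * (m * Re z) \<le> m * norm (exp (of_nat (2 * j + 1) * z) - 1)"
    using m by (intro mult_left_mono) auto
  have "norm (2 / (of_nat (2 * j + 1) * (exp (of_nat (2 * j + 1) * z) - 1)))
      = 2 / (m * norm (exp (of_nat (2 * j + 1) * z) - 1))"
    by (simp add: norm_divide norm_mult m_def del: of_nat_mult of_nat_add of_nat_Suc) 
  also have "\<dots> \<le> 2 / (m * (m * Re z))"
  proof (rule divide_left_mono[OF le])
    have "0 < m * (m * Re z)" using m assms by simp
    then show "0 < m * norm (exp (of_nat (2 * j + 1) * z) - 1) * (m * (m * Re z))"
      using le by (metis less_le_trans mult_pos_pos)
  qed simp
  also have "\<dots> \<le> 2 / (real (Suc j) * (real (Suc j) * Re z))"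
    using m assms by (intro divide_left_mono mult_pos_pos mult_mono) auto
  finally show ?thesis by (simp add: power2_eq_square mult.assoc mult.commute mult.left_commute)
qed

lemma summable_inverse_squares_Suc: "summable (\<lambda>j. c * (1 / real (Suc j) ^ 2))"
  by (intro summable_mult) (use inverse_squares_sums in \<open>simp add: sums_iff add.commute\<close>)

lemma summable_norm_log_gf:
  fixes z :: complex
  assumes "Re z > 0"
  shows "summable (\<lambda>j. norm (2 / (of_nat (2 * j + 1) * (exp (of_nat (2 * j + 1) * z) - 1))))"
  by (rule summable_comparison_test'[OF summable_inverse_squares_Suc[of "2 / Re z"], of 0])
     (use norm_log_gf_term_le[OF assms] in simp)

lemma sums_log_gf_complex:
  fixes z :: complex
  assumes "Re z > 0"
  shows "(\<lambda>j. 2 / (of_nat (2 * j + 1) * (exp (of_nat (2 * j + 1) * z) - 1))) sums log_gf z"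
  unfolding log_gf_def
  by (rule summable_sums, rule summable_norm_cancel, rule summable_norm_log_gf[OF assms])

text \<open>\<open>log_gf\<close> is used at two types: the real instance carries the asymptotics on
  the axis, the complex one the integrand on the circle. The second fact lets values pass between
  them.\<close>

lemma sums_log_gf_real:
  fixes s :: real
  assumes "s > 0"
  shows "(\<lambda>j. 2 / (of_nat (2 * j + 1) * (exp (of_nat (2 * j + 1) * s) - 1))) sums log_gf s"
    and "log_gf (complex_of_real s) = complex_of_real (log_gf s)"
proof -
  have "(\<lambda>j. complex_of_real (2 / (of_nat (2 * j + 1) * (exp (of_nat (2 * j + 1) * s) - 1))))
      sums log_gf (complex_of_real s)"
    using sums_log_gf_complex[of "complex_of_real s"] assms
    by (simp add: exp_of_real[symmetric] del: of_nat_mult of_nat_add of_nat_Suc)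
  then have *: "summable (\<lambda>j. complex_of_real (2 / (of_nat (2 * j + 1) * (exp (of_nat (2 * j + 1) * s) - 1))))"
    and eq: "log_gf (complex_of_real s) =
       (\<Sum>j. complex_of_real (2 / (of_nat (2 * j + 1) * (exp (of_nat (2 * j + 1) * s) - 1))))"
    by (simp_all only: sums_iff)
  show 1: "(\<lambda>j. 2 / (of_nat (2 * j + 1) * (exp (of_nat (2 * j + 1) * s) - 1))) sums log_gf s"
    unfolding log_gf_def by (rule summable_sums) (use * in \<open>simp only: summable_complex_of_real\<close>)
  show "log_gf (complex_of_real s) = complex_of_real (log_gf s)"
    unfolding eq by (rule sums_unique[symmetric], rule sums_of_real[OF 1])
qed

text \<open>The even powers cancel between the two logarithmic series, which leaves the odd
  exponents.\<close>

lemma ln_quotient_sums: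
  fixes q :: complex
  assumes "norm q < 1"
  shows "(\<lambda>j. 2 * q ^ (2 * j + 1) / of_nat (2 * j + 1)) sums (ln (1 + q) - ln (1 - q))"
proof -
  have "(\<lambda>n. - ((-q) ^ n) / of_nat n - - ((- (-q)) ^ n) / of_nat n) sums (ln (1 + q) - ln (1 + - q))"
    using assms by (intro sums_diff Ln_series') auto
  then have "(\<lambda>n. (q ^ n - (-q) ^ n) / of_nat n) sums (ln (1 + q) - ln (1 - q))"
    by (simp add: diff_divide_distrib)
  then have "(\<lambda>j. (q ^ (2 * j + 1) - (-q) ^ (2 * j + 1)) / of_nat (2 * j + 1))
      sums (ln (1 + q) - ln (1 - q))"
  proof (subst sums_mono_reindex[of "\<lambda>j. 2 * j + 1"])
    fix n :: nat assume "n \<notin> range (\<lambda>j. 2 * j + 1)"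
    then have "even n" by (metis oddE rangeI)
    then show "(q ^ n - (-q) ^ n) / of_nat n = 0" by simp
  qed (auto simp: strict_mono_def)
  then show ?thesis by simp
qed

lemma exp_ln_quotient:
  fixes q :: complex
  assumes "norm q < 1"
  shows "exp (ln (1 + q) - ln (1 - q)) = (1 + q) / (1 - q)"
proof -
  have "1 + q \<noteq> 0" using assms by (metis add_eq_0_iff norm_minus_cancel norm_one less_irrefl)
  moreover have "1 - q \<noteq> 0" using assms by auto
  ultimately show ?thesis by (simp add: exp_diff)
qed

text \<open>For finite \<open>M\<close> the sum over \<open>k\<close> is geometric for each
  \<open>j\<close>, so \<open>M\<close> enters only through the factor
  \<open>1 - (q ^ m j) ^ M\<close>, which Tannery's theorem removes. Comparing exponentials avoids
  the choice of a branch for the logarithm of the product.\<close>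

lemma prod_tendsto_exp_log_gf:
  fixes z :: complex
  assumes "Re z > 0"
  shows "(\<lambda>M. \<Prod>k=1..M. (1 + exp (- z) ^ k) / (1 - exp (- z) ^ k)) \<longlonglongrightarrow> exp (log_gf z)"
proof -
  define q where "q = exp (- z)"
  define m :: "nat \<Rightarrow> nat" where "m = (\<lambda>j. 2 * j + 1)"
  define t where "t j = 2 / (of_nat (m j) * (exp (of_nat (m j) * z) - 1))" for j
  have q: "norm q < 1" using assms by (simp add: q_def)
  have qk: "norm (q ^ k) < 1" if "k > 0" for k
    using q that by (simp add: norm_power power_less_one_iff)
  have qm: "norm (q ^ m j) < 1" for j
    by (rule qk) (simp add: m_def)
  have tq: "t j = 2 / of_nat (m j) * (q ^ m j / (1 - q ^ m j))" for j
  proof -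
    have e: "exp (of_nat (m j) * z) = 1 / q ^ m j"
      by (simp add: q_def exp_of_nat_mult[symmetric] exp_minus field_simps)
    have "q \<noteq> 0" by (simp add: q_def)
    then show ?thesis unfolding t_def e by (simp add: field_simps)
  qed
  have sumt: "summable (\<lambda>j. norm (t j))"
    unfolding t_def m_def by (rule summable_norm_log_gf[OF assms])
  have lim: "(\<lambda>M. \<Sum>j. t j * (1 - (q ^ m j) ^ M)) \<longlonglongrightarrow> (\<Sum>j. t j * (1 - 0))"
  proof (rule tannery)
    show "(\<lambda>M. t j * (1 - (q ^ m j) ^ M)) \<longlonglongrightarrow> t j * (1 - 0)" for j
      by (intro tendsto_intros LIMSEQ_power_zero qm)
    show "\<forall>\<^sub>F M in sequentially. \<forall>j. norm (t j * (1 - (q ^ m j) ^ M)) \<le> 2 * norm (t j)"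
    proof (intro always_eventually allI)
      fix M j
      have "norm (1 - (q ^ m j) ^ M) \<le> norm (1::complex) + norm ((q ^ m j) ^ M)" by (rule norm_triangle_ineq4)
      also have "norm ((q ^ m j) ^ M) \<le> 1"
        using qm[of j] by (simp add: norm_power power_le_one)
      finally show "norm (t j * (1 - (q ^ m j) ^ M)) \<le> 2 * norm (t j)"
        using mult_left_mono[of "norm (1 - (q ^ m j) ^ M)" 2 "norm (t j)"]
        by (simp add: norm_mult mult.commute)
    qed
    show "summable (\<lambda>j. 2 * norm (t j))" by (intro summable_mult sumt)
  qed simp
  have "(\<Prod>k=1..M. (1 + q ^ k) / (1 - q ^ k)) = exp (\<Sum>j. t j * (1 - (q ^ m j) ^ M))" for M
  proof -
    have "(\<lambda>j. \<Sum>k=1..M. 2 * (q ^ k) ^ m j / of_nat (m j)) sums (\<Sum>k=1..M. ln (1 + q ^ k) - ln (1 - q ^ k))"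
      unfolding m_def by (intro sums_sum ln_quotient_sums qk) auto
    moreover have "(\<Sum>k=1..M. 2 * (q ^ k) ^ m j / of_nat (m j)) = t j * (1 - (q ^ m j) ^ M)" for j
    proof -
      have ne: "1 - q ^ m j \<noteq> 0" using qm[of j] by auto
      have "(\<Sum>k=1..M. (q ^ m j) ^ k) = q ^ m j * (\<Sum>k<M. (q ^ m j) ^ k)"
        by (induction M) (simp_all add: algebra_simps)
      also have "(\<Sum>k<M. (q ^ m j) ^ k) = (1 - (q ^ m j) ^ M) / (1 - q ^ m j)"
        using ne by (subst sum_gp_strict) auto
      finally have g: "(\<Sum>k=1..M. (q ^ m j) ^ k) = q ^ m j * ((1 - (q ^ m j) ^ M) / (1 - q ^ m j))" .
      have "(\<Sum>k=1..M. 2 * (q ^ k) ^ m j / of_nat (m j)) = 2 / of_nat (m j) * (\<Sum>k=1..M. (q ^ m j) ^ k)"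
        by (simp add: sum_distrib_left power_mult[symmetric] mult.commute)
      then show ?thesis unfolding g tq by simp
    qed
    ultimately have "(\<Sum>j. t j * (1 - (q ^ m j) ^ M)) = (\<Sum>k=1..M. ln (1 + q ^ k) - ln (1 - q ^ k))"
      by (simp add: sums_iff)
    then show ?thesis by (simp add: exp_sum exp_ln_quotient qk)
  qed
  moreover have "(\<Sum>j. t j) = log_gf z" by (simp add: log_gf_def t_def m_def)
  ultimately show ?thesis using tendsto_exp[OF lim] by (simp add: q_def)
qed

section \<open>The power series of the overpartition numbers\<close>

lemma card_int_abs_mult_eq:
  assumes "k > 0"
  shows "card {x::int. k * nat \<bar>x\<bar> = k * j} = (if j = 0 then 1 else 2)"
proof -
  have "{x::int. k * nat \<bar>x\<bar> = k * j} = {int j, - int j}"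
    using assms by auto
  then show ?thesis by auto
qed

text \<open>The coefficients at the multiples of \<open>k\<close> are \<open>1, 2, 2, ...\<close>: a
  part that occurs may be overlined or not, an absent one has no choice. Hence the series is
  \<open>2 / (1 - q ^ k) - 1\<close>.\<close>

lemma quotient_sums:
  fixes q :: "'a :: {real_normed_field, banach}"
  assumes "norm q < 1" "k > 0"
  shows "(\<lambda>i. of_nat (card {x::int. k * nat \<bar>x\<bar> = i}) * q ^ i) sums ((1 + q ^ k) / (1 - q ^ k))"
proof -
  have qk: "norm (q ^ k) < 1" using assms by (simp add: norm_power power_less_one_iff)
  then have ne: "1 - q ^ k \<noteq> 0" by auto
  have "(\<lambda>j. 2 * (q ^ k) ^ j - (if j = 0 then 1 else 0)) sums (2 * (1 / (1 - q ^ k)) - 1)"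
    using sums_single[of 0 "\<lambda>_. 1 :: 'a"]
    by (intro sums_diff sums_mult geometric_sums qk) simp
  also have "2 * (1 / (1 - q ^ k)) - 1 = (1 + q ^ k) / (1 - q ^ k)"
    using ne by (simp add: field_simps)
  also have "(\<lambda>j. 2 * (q ^ k) ^ j - (if j = 0 then 1 else 0)) =
      (\<lambda>j. of_nat (card {x::int. k * nat \<bar>x\<bar> = k * j}) * q ^ (k * j))"
    unfolding card_int_abs_mult_eq[OF assms(2)] by (auto simp: power_mult fun_eq_iff)
  finally show ?thesis
  proof (subst (asm) sums_mono_reindex[of "\<lambda>j. k * j"])
    show "strict_mono (\<lambda>j. k * j)" using assms by (simp add: strict_mono_def)
    fix i assume "i \<notin> range (\<lambda>j. k * j)"
    then have "{x::int. k * nat \<bar>x\<bar> = i} = {}" by auto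
    then show "of_nat (card {x::int. k * nat \<bar>x\<bar> = i}) * q ^ i = 0" by (simp only: card.empty) simp
  qed
qed

lemma signed_partitions_sums_aux:
  fixes q :: "'a :: {real_normed_field, banach}"
  assumes q: "norm q < 1"
    and abs: "\<And>M. summable (\<lambda>n. norm (of_nat (card (signed_partitions M n)) * q ^ n))"
  shows "(\<lambda>n. of_nat (card (signed_partitions M n)) * q ^ n) sums
           (\<Prod>k=1..M. (1 + q ^ k) / (1 - q ^ k))"
proof (induction M)
  case 0
  have "(\<lambda>n. of_nat (card (signed_partitions 0 n)) * q ^ n) = (\<lambda>n. if n = 0 then 1 else 0)"
    by (auto simp: signed_partitions_0 fun_eq_iff)
  then show ?case using sums_single[of 0 "\<lambda>_. 1 :: 'a"] by simp
next
  case (Suc M)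
  let ?c = "\<lambda>i. of_nat (card {x::int. Suc M * nat \<bar>x\<bar> = i}) * q ^ i"
  have c: "?c sums ((1 + q ^ Suc M) / (1 - q ^ Suc M))"
    by (rule quotient_sums[OF q]) simp
  have "(\<lambda>i. of_nat (card {x::int. Suc M * nat \<bar>x\<bar> = i}) * norm q ^ i) sums
      ((1 + norm q ^ Suc M) / (1 - norm q ^ Suc M))"
    by (rule quotient_sums) (use q in auto)
  then have "summable (\<lambda>i. norm (?c i))"
    by (simp add: sums_iff norm_mult norm_power)
  from Cauchy_product_sums[OF this abs[of M]]
  have "(\<lambda>n. \<Sum>i\<le>n. ?c i * (of_nat (card (signed_partitions M (n - i))) * q ^ (n - i))) sums
      ((1 + q ^ Suc M) / (1 - q ^ Suc M) * (\<Prod>k=1..M. (1 + q ^ k) / (1 - q ^ k)))"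
    using c Suc.IH by (simp only: sums_iff)
  moreover have "(\<Sum>i\<le>n. ?c i * (of_nat (card (signed_partitions M (n - i))) * q ^ (n - i))) =
      of_nat (card (signed_partitions (Suc M) n)) * q ^ n" for n
    unfolding card_signed_partitions_Suc of_nat_sum of_nat_mult sum_distrib_right
  proof (intro sum.cong refl)
    fix i assume "i \<in> {..n}"
    then have "q ^ n = q ^ i * q ^ (n - i)" by (simp add: power_add[symmetric])
    then show "?c i * (of_nat (card (signed_partitions M (n - i))) * q ^ (n - i)) =
      of_nat (card {x::int. Suc M * nat \<bar>x\<bar> = i}) * of_nat (card (signed_partitions M (n - i))) * q ^ n"
      by simp
  qed
  ultimately show ?case by (simp add: mult.commute)
qed

lemma summable_signed_partitions:
  fixes r :: real
  assumes "0 \<le> r" "r < 1"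
  shows "summable (\<lambda>n. real (card (signed_partitions M n)) * r ^ n)"
proof (induction M)
  case 0
  show ?case
    by (rule summable_finite[of "{0}"]) (auto simp: signed_partitions_0)
next
  case (Suc M)
  let ?c = "\<lambda>i. real (card {x::int. Suc M * nat \<bar>x\<bar> = i}) * r ^ i"
  have "?c sums ((1 + r ^ Suc M) / (1 - r ^ Suc M))"
    by (rule quotient_sums) (use assms in auto)
  then have "summable (\<lambda>i. norm (?c i))" using assms by (simp add: sums_iff)
  moreover have "summable (\<lambda>n. norm (real (card (signed_partitions M n)) * r ^ n))"
    using Suc.IH assms by simp
  ultimately have "summable (\<lambda>n. \<Sum>i\<le>n. ?c i * (real (card (signed_partitions M (n - i))) * r ^ (n - i)))"
    by (rule sums_summable[OF Cauchy_product_sums])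
  moreover have "(\<Sum>i\<le>n. ?c i * (real (card (signed_partitions M (n - i))) * r ^ (n - i))) =
      real (card (signed_partitions (Suc M) n)) * r ^ n" for n
    unfolding card_signed_partitions_Suc of_nat_sum of_nat_mult sum_distrib_right
  proof (intro sum.cong refl)
    fix i assume "i \<in> {..n}"
    then have "r ^ n = r ^ i * r ^ (n - i)" by (simp add: power_add[symmetric])
    then show "?c i * (real (card (signed_partitions M (n - i))) * r ^ (n - i)) =
      real (card {x::int. Suc M * nat \<bar>x\<bar> = i}) * real (card (signed_partitions M (n - i))) * r ^ n"
      by simp
  qed
  ultimately show ?case by simp
qed

lemma signed_partitions_sums:
  fixes q :: "'a :: {real_normed_field, banach}"
  assumes "norm q < 1"
  shows "(\<lambda>n. of_nat (card (signed_partitions M n)) * q ^ n) sums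
           (\<Prod>k=1..M. (1 + q ^ k) / (1 - q ^ k))"
  using summable_signed_partitions[of "norm q"] assms
  by (intro signed_partitions_sums_aux) (simp_all add: norm_mult norm_power)

lemma prod_tendsto_exp_log_gf_real:
  fixes s :: real
  assumes "s > 0"
  shows "(\<lambda>M. \<Prod>k=1..M. (1 + exp (- s) ^ k) / (1 - exp (- s) ^ k)) \<longlonglongrightarrow> exp (log_gf s)"
    (is "?P \<longlonglongrightarrow> _")
proof -
  have "(\<lambda>M. complex_of_real (?P M)) \<longlonglongrightarrow> exp (log_gf (complex_of_real s))"
    using prod_tendsto_exp_log_gf[of "complex_of_real s"] assms
    by (simp add: exp_of_real[symmetric] flip: of_real_minus)
  then have "(\<lambda>M. complex_of_real (?P M)) \<longlonglongrightarrow> complex_of_real (exp (log_gf s))"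
    using sums_log_gf_real(2)[OF assms] by (simp add: exp_of_real)
  then show ?thesis by (simp only: tendsto_of_real_iff)
qed

text \<open>The first \<open>N\<close> coefficients are already those with parts at most
  \<open>N\<close>, so a partial sum is bounded by a finite product, and the finite products
  converge.\<close>

lemma summable_overpartitions:
  fixes s :: real
  assumes "s > 0"
  shows "summable (\<lambda>n. real (overpartitions n) * exp (- s) ^ n)"
proof -
  define r where "r = exp (- s)"
  have r: "0 \<le> r" "r < 1" using assms by (auto simp: r_def)
  define P where "P M = (\<Prod>k=1..M. (1 + r ^ k) / (1 - r ^ k))" for M
  have "P \<longlonglongrightarrow> exp (log_gf s)"
    using prod_tendsto_exp_log_gf_real[OF assms] by (simp add: P_def[abs_def] r_def)
  then have "Bseq P" by (intro convergent_imp_Bseq convergentI)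
  then obtain B where B: "\<And>M. P M \<le> B" unfolding Bseq_def by (metis abs_le_D1 real_norm_def)
  show ?thesis unfolding r_def[symmetric]
  proof (rule summableI_nonneg_bounded)
    show "0 \<le> real (overpartitions n) * r ^ n" for n using r by simp
    fix N
    have "(\<Sum>n<N. real (overpartitions n) * r ^ n) = (\<Sum>n<N. real (card (signed_partitions N n)) * r ^ n)"
      by (intro sum.cong) (auto simp: card_signed_partitions_eq)
    also have "\<dots> \<le> (\<Sum>n. real (card (signed_partitions N n)) * r ^ n)"
      using r by (intro sum_le_suminf summable_signed_partitions) auto
    also have "\<dots> = P N"
      using signed_partitions_sums[of r N] r by (simp add: sums_iff P_def)
    also have "\<dots> \<le> B" by (rule B)
    finally show "(\<Sum>n<N. real (overpartitions n) * r ^ n) \<le> B" .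
  qed
qed

text \<open>Both sides are limits of the same finite products: one by
  \<open>prod_tendsto_exp_log_gf\<close>, the other coefficientwise, dominated through
  \<open>card_signed_partitions_le\<close>.\<close>

lemma overpartitions_sums:
  fixes z :: complex
  assumes "Re z > 0"
  shows "(\<lambda>n. of_nat (overpartitions n) * exp (- z) ^ n) sums exp (log_gf z)"
proof -
  define q where "q = exp (- z)"
  have q: "norm q < 1" and nq: "norm q = exp (- Re z)" using assms by (simp_all add: q_def)
  have sm: "summable (\<lambda>n. real (overpartitions n) * norm q ^ n)"
    unfolding nq by (rule summable_overpartitions[OF assms])
  have "(\<lambda>M. \<Sum>n. of_nat (card (signed_partitions M n)) * q ^ n) \<longlonglongrightarrow> (\<Sum>n. of_nat (overpartitions n) * q ^ n)"
  proof (rule tannery[OF _ _ sm])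
    show "(\<lambda>M. of_nat (card (signed_partitions M n)) * q ^ n) \<longlonglongrightarrow> of_nat (overpartitions n) * q ^ n" for n
      by (rule tendsto_eventually, rule eventually_mono[OF eventually_ge_at_top[of n]])
         (simp add: card_signed_partitions_eq)
    show "\<forall>\<^sub>F M in sequentially. \<forall>n. norm (of_nat (card (signed_partitions M n)) * q ^ n)
        \<le> real (overpartitions n) * norm q ^ n"
      by (intro always_eventually allI)
         (simp add: norm_mult norm_power mult_right_mono card_signed_partitions_le)
  qed simp
  moreover have "(\<Sum>n. of_nat (card (signed_partitions M n)) * q ^ n) =
      (\<Prod>k=1..M. (1 + q ^ k) / (1 - q ^ k))" for M
    using signed_partitions_sums[OF q, of M] by (simp add: sums_iff)
  ultimately have "(\<lambda>M. \<Prod>k=1..M. (1 + q ^ k) / (1 - q ^ k)) \<longlonglongrightarrow> (\<Sum>n. of_nat (overpartitions n) * q ^ n)"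
    by simp
  with prod_tendsto_exp_log_gf[OF assms] have "exp (log_gf z) = (\<Sum>n. of_nat (overpartitions n) * q ^ n)"
    unfolding q_def by (rule LIMSEQ_unique)
  moreover have "summable (\<lambda>n. of_nat (overpartitions n) * q ^ n)"
    by (rule summable_norm_cancel) (use sm in \<open>simp add: norm_mult norm_power\<close>)
  ultimately show ?thesis by (simp add: sums_iff q_def)
qed

section \<open>Behaviour on the real axis\<close>

text \<open>This is \<open>ln (coth (x / 2))\<close>: convex, decreasing to 0, and close to
  \<open>- ln (x / 2)\<close> near 0.\<close>

definition log_coth :: "real \<Rightarrow> real" where
  "log_coth x = ln ((1 + exp (- x)) / (1 - exp (- x)))"

text \<open>The double series in its other order, with one term for each factor of the
  product.\<close>

lemma log_coth_sums:
  assumes "s > 0"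
  shows "(\<lambda>k. log_coth (real (Suc k) * s)) sums log_gf s"
proof -
  define r where "r = exp (- s)"
  have r: "0 < r" "r < 1" using assms by (auto simp: r_def)
  have pos: "0 < (1 + r ^ k) / (1 - r ^ k)" if "k \<ge> 1" for k
    using r that by (intro divide_pos_pos) (simp_all add: power_less_one_iff add_pos_pos)
  have "(\<lambda>M. ln (\<Prod>k=1..M. (1 + r ^ k) / (1 - r ^ k))) \<longlonglongrightarrow> ln (exp (log_gf s))"
    unfolding r_def by (intro tendsto_ln prod_tendsto_exp_log_gf_real assms) auto
  moreover have "ln (\<Prod>k=1..M. (1 + r ^ k) / (1 - r ^ k)) = (\<Sum>k<M. log_coth (real (Suc k) * s))" for M
  proof -
    have "ln (\<Prod>k=1..M. (1 + r ^ k) / (1 - r ^ k)) = (\<Sum>k=1..M. ln ((1 + r ^ k) / (1 - r ^ k)))"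
      using pos by (intro ln_prod finite_atLeastAtMost) (metis atLeastAtMost_iff less_irrefl)
    also have "\<dots> = (\<Sum>k=1..M. log_coth (real k * s))"
      by (intro sum.cong) (auto simp: log_coth_def r_def exp_of_nat_mult[symmetric])
    also have "\<dots> = (\<Sum>k<M. log_coth (real (Suc k) * s))"
      by (rule sum.reindex_bij_witness[of _ Suc "\<lambda>k. k - 1"]) auto
    finally show ?thesis .
  qed
  ultimately show ?thesis by (simp add: sums_def)
qed

lemma log_coth_convex:
  assumes "x > 0" "h \<ge> 0"
  shows "2 * log_coth (x + h) \<le> log_coth x + log_coth (x + 2 * h)"
proof -
  define y where "y = exp (- x)"
  define a where "a = exp (- h)"
  have y: "0 < y" "y < 1" and a: "0 < a" "a \<le> 1" using assms by (auto simp: y_def a_def)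
  have e1: "exp (- (x + h)) = y * a" by (simp add: y_def a_def exp_add[symmetric])
  have e2: "exp (- (x + 2 * h)) = y * (a * a)" by (simp add: y_def a_def exp_add[symmetric])
  have ya: "y * a < 1" using y a by (smt (verit) mult_left_le)
  have yaa: "y * (a * a) < 1" using y a ya by (smt (verit) mult_left_le mult.assoc mult_pos_pos)
  have "((1 + y * a) / (1 - y * a)) ^ 2 \<le> (1 + y) / (1 - y) * ((1 + y * (a * a)) / (1 - y * (a * a)))"
  proof -
    \<comment> \<open>Both sides have the form \<open>(N + w) / (N - w)\<close> with the same
      \<open>N\<close>, which increases with \<open>w\<close>; and \<open>u \<le> v\<close> amounts
      to \<open>2 * a \<le> 1 + a\<^sup>2\<close>.\<close>
    define N where "N = 1 + (y * a)\<^sup>2"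
    define u where "u = 2 * (y * a)"
    define v where "v = y * (1 + a\<^sup>2)"
    have uv: "u \<le> v"
    proof -
      have "v - u = y * (1 - a)\<^sup>2" by (simp add: u_def v_def power2_eq_square algebra_simps)
      then show ?thesis using y by (simp add: algebra_simps)
    qed
    have Nu: "N - u = (1 - y * a)\<^sup>2" "N + u = (1 + y * a)\<^sup>2"
      by (simp_all add: N_def u_def power2_eq_square algebra_simps)
    have Nv: "N - v = (1 - y) * (1 - y * (a * a))" "N + v = (1 + y) * (1 + y * (a * a))"
      by (simp_all add: N_def v_def power2_eq_square algebra_simps)
    have "N - u > 0" "N - v > 0" using y ya yaa unfolding Nu Nv by auto
    moreover have "N > 0" by (simp add: N_def add_pos_nonneg)
    ultimately have "(N + u) / (N - u) \<le> (N + v) / (N - v)"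
      using uv by (simp add: divide_simps algebra_simps)
    then show ?thesis unfolding Nu Nv by (simp add: power_divide)
  qed
  moreover have p: "0 < (1 + y * a) / (1 - y * a)" "0 < (1 + y) / (1 - y)"
      "0 < (1 + y * (a * a)) / (1 - y * (a * a))"
    using y a ya yaa by (auto intro!: divide_pos_pos add_pos_pos)
  ultimately have "ln (((1 + y * a) / (1 - y * a)) ^ 2)
      \<le> ln ((1 + y) / (1 - y) * ((1 + y * (a * a)) / (1 - y * (a * a))))"
    by (metis ln_mono mult_pos_pos zero_less_power)
  then have "2 * ln ((1 + y * a) / (1 - y * a))
      \<le> ln ((1 + y) / (1 - y)) + ln ((1 + y * (a * a)) / (1 - y * (a * a)))"
    unfolding ln_mult_pos[OF p(2,3)] using p(1) by (simp only: ln_realpow)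
  then show ?thesis unfolding log_coth_def e1 e2 y_def[symmetric] .
qed

lemma log_coth_tendsto_0: "(log_coth \<longlongrightarrow> 0) at_top"
  unfolding log_coth_def by real_asymp

text \<open>For \<open>y = exp (- x)\<close> the quotients \<open>(1 + y) / 2\<close> and
  \<open>(1 - y) / x\<close> both lie between \<open>1 - x / 2\<close> and \<open>1\<close>, so
  their logarithms lie in \<open>{- x..0}\<close>. A linear error suffices, as the estimate is
  applied at multiples \<open>j * s\<close> with \<open>j\<close> bounded while \<open>s\<close>
  tends to 0.\<close>

lemma log_coth_near_0:
  assumes "0 < x" "x \<le> 1"
  shows "\<bar>log_coth x + ln (x / 2)\<bar> \<le> x"
proof -
  define y where "y = exp (- x)"
  have y: "0 < y" "y < 1" using assms by (auto simp: y_def)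
  have l: "1 - x \<le> y" using exp_ge_add_one_self[of "- x"] by (simp add: y_def)
  have u: "y \<le> 1 - x + x\<^sup>2 / 2"
  proof -
    have "y * exp x = 1" by (simp add: y_def exp_minus)
    moreover have "exp x \<ge> 1 + x + x\<^sup>2 / 2" using assms exp_lower_Taylor_quadratic[of x] by simp
    \<comment> \<open>This product is at least \<open>1 = y * exp x\<close>, so cancelling
      \<open>1 + x + x\<^sup>2 / 2\<close> bounds \<open>y\<close> from above.\<close>
    moreover have "(1 - x + x\<^sup>2 / 2) * (1 + x + x\<^sup>2 / 2) = 1 + x ^ 4 / 4"
      by (simp add: power2_eq_square power4_eq_xxxx algebra_simps)
    moreover have "0 < 1 + x + x\<^sup>2 / 2" using assms by (simp add: add_pos_nonneg)
    ultimately have "y * (1 + x + x\<^sup>2 / 2) \<le> (1 - x + x\<^sup>2 / 2) * (1 + x + x\<^sup>2 / 2)"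
      using mult_left_mono[of "1 + x + x\<^sup>2 / 2" "exp x" y] y
      by (smt (verit) divide_nonneg_nonneg zero_le_even_power' even_numeral zero_le_power assms(1))
    then show ?thesis using \<open>0 < 1 + x + x\<^sup>2 / 2\<close> by (simp add: mult_le_cancel_right)
  qed
  have eq: "log_coth x + ln (x / 2) = ln ((1 + y) / 2) - ln ((1 - y) / x)"
    unfolding log_coth_def y_def[symmetric] using y assms by (simp add: ln_div ln_mult)
  have "(1 + y) / 2 \<ge> 1 - x / 2" using l by simp
  moreover have "(1 - y) / x \<ge> 1 - x / 2"
    using u assms by (simp add: field_simps power2_eq_square)
  moreover have "(1 - y) / x \<le> 1" using l assms by (simp add: field_simps)
  moreover have "(1 + y) / 2 \<le> 1" using y by simp
  moreover have "ln (1 - x / 2) \<ge> - x"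
  proof -
    have "x * x \<le> x * 1" using assms by (intro mult_left_mono) auto
    moreover have "- (x / 2) - x * x / 2 \<le> ln (1 - x / 2)"
      using ln_one_minus_pos_lower_bound[of "x / 2"] assms by (simp add: power2_eq_square)
    ultimately show ?thesis by simp
  qed
  moreover have "1 - x / 2 > 0" using assms by simp
  ultimately have "ln (1 - x / 2) \<le> ln ((1 + y) / 2)" "ln (1 - x / 2) \<le> ln ((1 - y) / x)"
      "ln ((1 + y) / 2) \<le> 0" "ln ((1 - y) / x) \<le> 0" "- x \<le> ln (1 - x / 2)"
    by (auto simp: ln_le_zero_iff)
  then show ?thesis unfolding eq by linarith
qed

section \<open>Alternating sums and the doubling relation\<close>

lemma alternating_tail_bounds:
  fixes f :: "nat \<Rightarrow> real"
  assumes convex: "\<And>k. 2 * f (Suc k) \<le> f k + f (k + 2)"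
    and lim: "f \<longlonglongrightarrow> 0"
    and sums: "(\<lambda>k. f (2 * k + 1) - f (2 * k + 2)) sums R"
  shows "f 1 / 2 \<le> R" "R \<le> f 0 / 2"
proof -
  have e: "(\<lambda>k. f (2 * k)) \<longlonglongrightarrow> 0"
    by (rule filterlim_compose[OF lim]) real_asymp
  have o: "(\<lambda>k. f (2 * k + 1)) \<longlonglongrightarrow> 0"
    by (rule filterlim_compose[OF lim]) real_asymp
  have "(\<lambda>k. f (2 * k) - f (2 * Suc k)) sums (f (2 * 0) - 0)"
    by (rule telescope_sums'[OF e])
  \<comment> \<open>By convexity the consecutive differences of \<open>f\<close> decrease. So each
    difference in the series is at most the average of itself and the one before, and, for the lower
    bound, at least the average of itself and the one after; both averages telescope.\<close>
  moreover have "2 * (f (2 * k + 1) - f (2 * k + 2)) \<le> f (2 * k) - f (2 * Suc k)" for k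
    using convex[of "2 * k"] by simp
  ultimately have "2 * R \<le> f (2 * 0) - 0"
    by (intro sums_le[OF _ sums_mult[OF sums]]) auto
  then show "R \<le> f 0 / 2" by simp
  have "(\<lambda>k. f (2 * k + 1) - f (2 * Suc k + 1)) sums (f (2 * 0 + 1) - 0)"
    by (rule telescope_sums'[OF o])
  moreover have "f (2 * k + 1) - f (2 * Suc k + 1) \<le> 2 * (f (2 * k + 1) - f (2 * k + 2))" for k
    using convex[of "2 * k + 1"] by (simp add: eval_nat_numeral)
  ultimately have "f (2 * 0 + 1) - 0 \<le> 2 * R"
    by (intro sums_le[OF _ _ sums_mult[OF sums]]) auto
  then show "f 1 / 2 \<le> R" by simp
qed

text \<open>The partial product has factors
  \<open>(2 * k + 2)\<^sup>2 / ((2 * k + 1) * (2 * k + 3))\<close>. Every odd number above 1 occurs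
  twice except the last, which is the separate \<open>ln (real (2 * K + 1))\<close>.\<close>

lemma wallis_log:
  "(\<lambda>K. 2 * (\<Sum>k<K. ln (real (2 * k + 2)) - ln (real (2 * k + 1))) - ln (real (2 * K + 1)))
     \<longlonglongrightarrow> ln (pi / 2)"
proof -
  have pos: "0 < 4 * (real k)\<^sup>2 / (4 * (real k)\<^sup>2 - 1)" if "k \<ge> 1" for k
  proof -
    have "1 \<le> (real k)\<^sup>2" using that by simp
    then have "4 * (real k)\<^sup>2 - 1 > 0" by linarith
    then show ?thesis using that by simp
  qed
  have "2 * (\<Sum>k<K. ln (real (2 * k + 2)) - ln (real (2 * k + 1))) - ln (real (2 * K + 1)) =
      ln (\<Prod>k=1..K. 4 * (real k)\<^sup>2 / (4 * (real k)\<^sup>2 - 1))" for K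
  proof (induction K)
    case (Suc K)
    define x where "x = real K"
    have x: "x \<ge> 0" by (simp add: x_def)
    have "0 < (\<Prod>k=1..K. 4 * (real k)\<^sup>2 / (4 * (real k)\<^sup>2 - 1))"
      by (intro prod_pos) (use pos in auto)
    then have "ln (\<Prod>k=1..Suc K. 4 * (real k)\<^sup>2 / (4 * (real k)\<^sup>2 - 1)) =
        ln (\<Prod>k=1..K. 4 * (real k)\<^sup>2 / (4 * (real k)\<^sup>2 - 1)) +
        ln (4 * (real (Suc K))\<^sup>2 / (4 * (real (Suc K))\<^sup>2 - 1))"
      using ln_mult_pos[OF _ pos[of "Suc K"]] by simp
    also have "4 * (real (Suc K))\<^sup>2 / (4 * (real (Suc K))\<^sup>2 - 1) =
        ((2 * x + 2) * (2 * x + 2)) / ((2 * x + 1) * (2 * x + 3))"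
      by (simp add: x_def power2_eq_square algebra_simps)
    also have "ln \<dots> = 2 * ln (2 * x + 2) - ln (2 * x + 1) - ln (2 * x + 3)"
      using x by (simp add: ln_div ln_mult_pos)
    finally show ?case using Suc.IH by (simp add: x_def algebra_simps)
  qed simp
  moreover have "(\<lambda>K. ln (\<Prod>k=1..K. 4 * (real k)\<^sup>2 / (4 * (real k)\<^sup>2 - 1))) \<longlonglongrightarrow> ln (pi / 2)"
    by (intro tendsto_ln wallis) simp
  ultimately show ?thesis by simp
qed

text \<open>The even multiples of \<open>s\<close> are the multiples of \<open>2 * s\<close>;
  subtracting them twice reverses their sign.\<close>

lemma log_gf_doubling_sums:
  assumes "s > 0"
  shows "(\<lambda>k. log_coth (real (2 * k + 1) * s) - log_coth (real (2 * k + 2) * s)) sums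
           (log_gf s - 2 * log_gf (2 * s))"
proof -
  have "(\<lambda>k. \<Sum>i\<in>{k * 2..<k * 2 + 2}. log_coth (real (Suc i) * s)) sums log_gf s"
    by (rule sums_group[OF log_coth_sums[OF assms]]) simp
  moreover have "(\<lambda>k. 2 * log_coth (real (Suc k) * (2 * s))) sums (2 * log_gf (2 * s))"
    using assms by (intro sums_mult log_coth_sums) auto
  ultimately have "(\<lambda>k. (\<Sum>i\<in>{k * 2..<k * 2 + 2}. log_coth (real (Suc i) * s)) -
      2 * log_coth (real (Suc k) * (2 * s))) sums (log_gf s - 2 * log_gf (2 * s))"
    by (rule sums_diff)
  moreover have "(\<Sum>i\<in>{k * 2..<k * 2 + 2}. log_coth (real (Suc i) * s)) -
      2 * log_coth (real (Suc k) * (2 * s)) =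
      log_coth (real (2 * k + 1) * s) - log_coth (real (2 * k + 2) * s)" for k
  proof -
    have 1: "{k * 2..<k * 2 + 2} = {2 * k, 2 * k + 1}" by auto
    have 2: "real (Suc k) * (2 * s) = real (2 * k + 2) * s" by (simp add: algebra_simps)
    have 3: "(\<Sum>i\<in>{2 * k, 2 * k + 1}. log_coth (real (Suc i) * s)) =
        log_coth (real (2 * k + 1) * s) + log_coth (real (2 * k + 2) * s)"
      by (simp add: add.commute)
    show ?thesis unfolding 1 2 3 by simp
  qed
  ultimately show ?thesis by simp
qed

text \<open>The alternating sum is split after \<open>K\<close> pairs. In the head
  \<open>ln (s / 2)\<close> cancels within each pair and \<open>H\<close> remains. The tail is about
  half its first value, \<open>- (ln (2 * K) + ln (s / 2)) / 2\<close>. In the sum, Wallis' product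
  turns \<open>H - ln (2 * K) / 2\<close> into \<open>ln (pi / 2) / 2\<close>, and the two
  \<open>ln 2\<close> cancel.\<close>

lemma log_gf_doubling_bound:
  assumes s: "s > 0" and K: "K \<ge> 1" and small: "real (2 * K + 1) * s \<le> 1"
  defines "H \<equiv> (\<Sum>k<K. ln (real (2 * k + 2)) - ln (real (2 * k + 1)))"
  shows "\<bar>log_gf s - 2 * log_gf (2 * s) + ln s / 2 - ln pi / 2\<bar>
    \<le> \<bar>2 * H - ln (real (2 * K + 1)) - ln (pi / 2)\<bar>
      + (ln (real (2 * K + 1)) - ln (real (2 * K))) + 7 * (real K)\<^sup>2 * s"
proof -
  define e where "e k = log_coth (real (2 * k + 1) * s) - log_coth (real (2 * k + 2) * s)" for k
  define A where "A = log_gf s - 2 * log_gf (2 * s)"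
  define R where "R = A - (\<Sum>k<K. e k)"
  have A: "e sums A" unfolding e_def A_def by (rule log_gf_doubling_sums[OF s])
  have R: "(\<lambda>k. e (k + K)) sums R" unfolding R_def by (rule sums_split_initial_segment[OF A])
  define f where "f k = log_coth (real (2 * K + k) * s)" for k
  have f: "(\<lambda>k. f (2 * k + 1) - f (2 * k + 2)) sums R"
    using R by (simp add: f_def e_def algebra_simps)
  have conv: "2 * f (Suc k) \<le> f k + f (k + 2)" for k
  proof -
    have "0 < real (2 * K + k) * s" using s K by simp
    from log_coth_convex[OF this, of s] s show ?thesis by (simp add: f_def algebra_simps)
  qed
  have "filterlim (\<lambda>k. real (2 * K + k) * s) at_top sequentially"
    using s by real_asymp
  then have "f \<longlonglongrightarrow> 0" unfolding f_def by (rule filterlim_compose[OF log_coth_tendsto_0])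
  note tail = alternating_tail_bounds[OF conv this f]
  define v where "v x = log_coth x + ln (x / 2)" for x
  have v: "\<bar>v (real j * s)\<bar> \<le> real j * s" if "1 \<le> j" "j \<le> 2 * K + 1" for j
    unfolding v_def
  proof (rule log_coth_near_0)
    have "real j * s \<le> real (2 * K + 1) * s" using that s by (intro mult_right_mono) auto
    then show "real j * s \<le> 1" using small by linarith
  qed (use that s in auto)
  have lc: "log_coth (real j * s) = v (real j * s) - ln (real j) - ln (s / 2)" if "1 \<le> j" for j
  proof -
    have "real j * s / 2 = real j * (s / 2)" by simp
    then have "ln (real j * s / 2) = ln (real j) + ln (s / 2)"
      using that s by (metis ln_mult_pos half_gt_zero of_nat_0_less_iff less_le_trans zero_less_one)
    then show ?thesis by (simp add: v_def)
  qed
  \<comment> \<open>The coefficient 7 of the claim is 4 from the head, \<open>K\<close> pairs with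
    error at most \<open>4 * K * s\<close> each, and 3 from the tail by
    \<open>2 * K + 1 \<le> 3 * K\<^sup>2\<close>.\<close>
  have head: "\<bar>(\<Sum>k<K. e k) - H\<bar> \<le> 4 * (real K)\<^sup>2 * s"
  proof -
    have "(\<Sum>k<K. e k) - H = (\<Sum>k<K. v (real (2 * k + 1) * s) - v (real (2 * k + 2) * s))"
      unfolding H_def sum_subtractf[symmetric] by (intro sum.cong) (auto simp only: e_def lc)
    also have "\<bar>\<dots>\<bar> \<le> (\<Sum>k<K. \<bar>v (real (2 * k + 1) * s) - v (real (2 * k + 2) * s)\<bar>)"
      by (rule sum_abs)
    also have "\<dots> \<le> (\<Sum>k<K. 4 * real K * s)"
    proof (rule sum_mono)
      fix k assume k: "k \<in> {..<K}"
      have 1: "\<bar>v (real (2 * k + 1) * s)\<bar> \<le> real (2 * k + 1) * s"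
        using k by (intro v) auto
      have 2: "\<bar>v (real (2 * k + 2) * s)\<bar> \<le> real (2 * k + 2) * s"
        using k by (intro v) auto
      have "real (2 * k + 1) * s \<le> real (2 * K) * s" "real (2 * k + 2) * s \<le> real (2 * K) * s"
        using k s by (intro mult_right_mono; simp)+
      then show "\<bar>v (real (2 * k + 1) * s) - v (real (2 * k + 2) * s)\<bar> \<le> 4 * real K * s"
        using 1 2 by (simp add: abs_le_iff)
    qed
    finally show ?thesis by (simp add: power2_eq_square algebra_simps)
  qed
  have f1: "f 1 = v (real (2 * K + 1) * s) - ln (real (2 * K + 1)) - ln (s / 2)"
    unfolding f_def by (rule lc) simp
  have f0: "f 0 = v (real (2 * K) * s) - ln (real (2 * K)) - ln (s / 2)"
    using lc[of "2 * K"] K by (simp add: f_def)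
  have v1: "\<bar>v (real (2 * K + 1) * s)\<bar> \<le> 3 * (real K)\<^sup>2 * s"
  proof -
    have "real K * 1 \<le> real K * real K" using K by (intro mult_left_mono) auto
    moreover have "1 \<le> real K" using K by simp
    ultimately have "real (2 * K + 1) \<le> 3 * (real K)\<^sup>2"
      unfolding power2_eq_square of_nat_add of_nat_mult by linarith
    then have "real (2 * K + 1) * s \<le> 3 * (real K)\<^sup>2 * s" using s by (intro mult_right_mono) auto
    then show ?thesis using v[of "2 * K + 1"] by linarith
  qed
  have v0: "\<bar>v (real (2 * K) * s)\<bar> \<le> 3 * (real K)\<^sup>2 * s"
  proof -
    have "real K * 1 \<le> real K * real K" using K by (intro mult_left_mono) auto
    then have "real (2 * K) \<le> 3 * (real K)\<^sup>2" using K by (simp add: power2_eq_square)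
    then have "real (2 * K) * s \<le> 3 * (real K)\<^sup>2 * s" using s by (intro mult_right_mono) auto
    then show ?thesis using v[of "2 * K"] K by linarith
  qed
  have l1: "ln (s / 2) = ln s - ln 2" "ln (pi / 2) = ln pi - ln 2" using s by (simp_all add: ln_div)
  have l2: "ln (real (2 * K)) \<le> ln (real (2 * K + 1))" using K by simp
  have "A = R + (\<Sum>k<K. e k)" by (simp add: R_def)
  then show ?thesis
    unfolding A_def[symmetric] using tail head v1 v0 f1 f0 l1 l2 by (simp add: abs_le_iff abs_if) argo
qed

text \<open>The error has a part \<open>E K\<close> that depends on \<open>K\<close> alone and tends
  to 0, and a part of size \<open>K\<^sup>2 * s\<close>. So \<open>K\<close> is fixed first and
  \<open>s\<close> shrinks afterwards.\<close>

lemma log_gf_doubling_tendsto: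
  "((\<lambda>s. log_gf s - 2 * log_gf (2 * s) + ln s / 2) \<longlongrightarrow> ln pi / 2) (at_right (0::real))"
proof (rule tendstoI)
  fix \<epsilon> :: real assume "\<epsilon> > 0"
  define E where "E K = \<bar>2 * (\<Sum>k<K. ln (real (2 * k + 2)) - ln (real (2 * k + 1))) - ln (real (2 * K + 1)) - ln (pi / 2)\<bar>
      + (ln (real (2 * K + 1)) - ln (real (2 * K)))" for K
  have "E \<longlonglongrightarrow> \<bar>ln (pi / 2) - ln (pi / 2)\<bar> + 0"
    unfolding E_def
    by (intro tendsto_add tendsto_rabs tendsto_diff wallis_log tendsto_const) real_asymp
  then have "eventually (\<lambda>K. E K < \<epsilon> / 2) sequentially"
    using \<open>\<epsilon> > 0\<close> by (intro order_tendstoD(2)[where y = "\<bar>ln (pi / 2) - ln (pi / 2)\<bar> + 0"]) auto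
  then have "eventually (\<lambda>K. E K < \<epsilon> / 2 \<and> K \<ge> 1) sequentially"
    using eventually_ge_at_top[of 1] by eventually_elim auto
  then obtain K where K: "E K < \<epsilon> / 2" "K \<ge> 1" using eventually_happens by fastforce
  have "eventually (\<lambda>s. real (2 * K + 1) * s < 1) (at_right 0)"
    by real_asymp
  moreover have "eventually (\<lambda>s. 7 * (real K)\<^sup>2 * s < \<epsilon> / 2) (at_right 0)"
    using \<open>\<epsilon> > 0\<close> by real_asymp
  ultimately show "\<forall>\<^sub>F s in at_right 0. dist (log_gf s - 2 * log_gf (2 * s) + ln s / 2) (ln pi / 2) < \<epsilon>"
    using eventually_at_right_less[of 0]
  proof eventually_elim
    case (elim s)
    have "\<bar>log_gf s - 2 * log_gf (2 * s) + ln s / 2 - ln pi / 2\<bar> \<le> E K + 7 * (real K)\<^sup>2 * s"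
      unfolding E_def using log_gf_doubling_bound[of s K] elim K by simp
    then show ?case using elim K by (simp add: dist_real_def)
  qed
qed

section \<open>The leading order and the full expansion on the axis\<close>

lemma odd_inverse_squares_sums: "(\<lambda>j. 1 / real (2 * j + 1) ^ 2) sums (pi\<^sup>2 / 8)"
proof -
  have 1: "(\<lambda>n. 1 / real (Suc n) ^ 2) sums (pi\<^sup>2 / 6)"
    using inverse_squares_sums by (simp add: add.commute)
  have "(\<lambda>n. \<Sum>i\<in>{n * 2..<n * 2 + 2}. 1 / real (Suc i) ^ 2) sums (pi\<^sup>2 / 6)"
    by (rule sums_group[OF 1]) simp
  moreover have "(\<lambda>n. 1 / 4 * (1 / real (Suc n) ^ 2)) sums (1 / 4 * (pi\<^sup>2 / 6))"
    by (rule sums_mult[OF 1])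
  ultimately have "(\<lambda>n. (\<Sum>i\<in>{n * 2..<n * 2 + 2}. 1 / real (Suc i) ^ 2) - 1 / 4 * (1 / real (Suc n) ^ 2))
      sums (pi\<^sup>2 / 6 - 1 / 4 * (pi\<^sup>2 / 6))"
    by (rule sums_diff)
  moreover have "(\<Sum>i\<in>{n * 2..<n * 2 + 2}. 1 / real (Suc i) ^ 2) - 1 / 4 * (1 / real (Suc n) ^ 2) =
      1 / real (2 * n + 1) ^ 2" for n
  proof -
    have "{n * 2..<n * 2 + 2} = {2 * n, 2 * n + 1}" by auto
    then have "(\<Sum>i\<in>{n * 2..<n * 2 + 2}. 1 / real (Suc i) ^ 2) = 1 / real (2 * n + 1) ^ 2 + 1 / (real (2 * n + 2)) ^ 2"
      by (simp add: add.commute)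
    moreover have "real (2 * n + 2) ^ 2 = 4 * real (Suc n) ^ 2"
      by (simp add: power2_eq_square algebra_simps)
    ultimately show ?thesis by simp
  qed
  ultimately show ?thesis by simp
qed

lemma log_gf_leading_order: "((\<lambda>s. s * log_gf s) \<longlongrightarrow> pi\<^sup>2 / 4) (at_right (0::real))"
proof -
  define t where "t j s = s * (2 / (of_nat (2 * j + 1) * (exp (of_nat (2 * j + 1) * s) - 1)))" for j and s :: real
  have "((\<lambda>s. \<Sum>j. t j s) \<longlongrightarrow> (\<Sum>j. 2 * (1 / real (2 * j + 1) ^ 2))) (at_right 0)"
  proof (rule tannery)
    show "((\<lambda>s. t j s) \<longlongrightarrow> 2 * (1 / real (2 * j + 1) ^ 2)) (at_right 0)" for j
    proof -
      have "((\<lambda>s. s * (2 / (m * (exp (m * s) - 1)))) \<longlongrightarrow> 2 * (1 / m ^ 2)) (at_right 0)"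
        if "m > 0" for m :: real
        using that by real_asymp (simp add: field_simps power2_eq_square)
      from this[of "real (2 * j + 1)"] show ?thesis unfolding t_def by simp
    qed
    show "summable (\<lambda>j. 2 * (1 / real (2 * j + 1) ^ 2))"
      using odd_inverse_squares_sums sums_summable by (intro summable_mult) blast
    show "\<forall>\<^sub>F s in at_right 0. \<forall>j. norm (t j s) \<le> 2 * (1 / real (2 * j + 1) ^ 2)"
      using eventually_at_right_less[of 0]
    proof eventually_elim
      case (elim s)
      show ?case
      proof
        fix j
        define m where "m = real (2 * j + 1)"
        have m: "m > 0" by (simp add: m_def)
        have "m * s \<le> exp (m * s) - 1" using exp_ge_add_one_self[of "m * s"] by linarith
        then have le: "m * (m * s) \<le> m * (exp (m * s) - 1)" using m by (intro mult_left_mono) auto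
        have pos: "0 < m * (m * s)" using m elim by simp
        have "norm (t j s) = s * (2 / (m * (exp (m * s) - 1)))"
          unfolding t_def m_def[symmetric] real_norm_def
          by (rule abs_of_nonneg, rule mult_nonneg_nonneg[OF less_imp_le[OF elim] divide_nonneg_pos])
             (use le pos in linarith)+
        also have "\<dots> \<le> s * (2 / (m * (m * s)))"
          by (rule mult_left_mono[OF divide_left_mono[OF le]])
             (use le pos elim mult_pos_pos[OF less_le_trans[OF pos le] pos] in auto)
        also have "\<dots> = 2 * (1 / m ^ 2)" using elim m by (simp add: power2_eq_square)
        finally show "norm (t j s) \<le> 2 * (1 / real (2 * j + 1) ^ 2)" by (simp only: m_def)
      qed
    qed
  qed simp
  also have "(\<Sum>j. 2 * (1 / real (2 * j + 1) ^ 2)) = pi\<^sup>2 / 4"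
    using sums_mult[OF odd_inverse_squares_sums, of 2] by (simp add: sums_iff)
  finally have lim: "((\<lambda>s. \<Sum>j. t j s) \<longlongrightarrow> pi\<^sup>2 / 4) (at_right 0)" .
  have "\<forall>\<^sub>F s in at_right 0. (\<Sum>j. t j s) = s * log_gf s"
    using eventually_at_right_less[of 0]
  proof eventually_elim
    case (elim s)
    then show ?case using sums_mult[OF sums_log_gf_real(1)[OF elim], of s] by (simp add: t_def sums_iff)
  qed
  with lim show ?thesis by (rule Lim_transform_eventually)
qed

text \<open>The functions \<open>c / s\<close> satisfy \<open>U s = 2 * U (2 * s)\<close> exactly;
  the second premise excludes them. Read as \<open>U s = U (s / 2) / 2 + o(1)\<close>, the relation
  contracts when iterated towards 0: the errors add up geometrically, and
  \<open>U (t / 2 ^ j) / 2 ^ j\<close> vanishes by the second premise.\<close>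

lemma tendsto_0_of_doubling:
  fixes U :: "real \<Rightarrow> real"
  assumes dbl: "((\<lambda>s. U s - 2 * U (2 * s)) \<longlongrightarrow> 0) (at_right 0)"
    and small: "((\<lambda>s. s * U s) \<longlongrightarrow> 0) (at_right 0)"
  shows "(U \<longlongrightarrow> 0) (at_right 0)"
proof (rule tendstoI)
  fix \<epsilon> :: real assume e: "\<epsilon> > 0"
  have "eventually (\<lambda>s. \<bar>U s - 2 * U (2 * s)\<bar> < \<epsilon> / 2) (at_right 0)"
    using tendstoD[OF dbl, of "\<epsilon> / 2"] e by (simp add: dist_real_def)
  then obtain \<delta> where \<delta>: "\<delta> > 0" "\<And>s. 0 < s \<Longrightarrow> s < \<delta> \<Longrightarrow> \<bar>U s - 2 * U (2 * s)\<bar> < \<epsilon> / 2"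
    unfolding eventually_at_right_field by auto
  have "\<bar>U t\<bar> < \<epsilon>" if t: "0 < t" "t < \<delta>" for t
  proof -
    have step: "\<bar>U x\<bar> \<le> \<bar>U (x / 2)\<bar> / 2 + \<epsilon> / 4" if "0 < x" "x < \<delta>" for x
    proof -
      have "\<bar>U (x / 2) - 2 * U (2 * (x / 2))\<bar> < \<epsilon> / 2" using that by (intro \<delta>) auto
      then show ?thesis by (simp add: abs_if split: if_splits)
    qed
    have iter: "\<bar>U t\<bar> \<le> \<bar>U (t / 2 ^ j)\<bar> / 2 ^ j + \<epsilon> / 2" for j
    proof -
      have "\<bar>U t\<bar> \<le> \<bar>U (t / 2 ^ j)\<bar> / 2 ^ j + (\<epsilon> / 2) * (1 - 1 / 2 ^ j)"
      proof (induction j)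
        case (Suc j)
        have "t / 2 ^ j \<le> t" using t by (simp add: field_simps)
        then have "\<bar>U (t / 2 ^ j)\<bar> \<le> \<bar>U (t / 2 ^ j / 2)\<bar> / 2 + \<epsilon> / 4"
          using t by (intro step) auto
        then have "\<bar>U (t / 2 ^ j)\<bar> / 2 ^ j \<le> (\<bar>U (t / 2 ^ j / 2)\<bar> / 2 + \<epsilon> / 4) / 2 ^ j"
          by (intro divide_right_mono) auto
        with Suc.IH show ?case by (simp add: field_simps)
      qed simp
      moreover have "(\<epsilon> / 2) * (1 - 1 / 2 ^ j) \<le> \<epsilon> / 2" using e by (simp add: field_simps)
      ultimately show ?thesis by linarith
    qed
    have "filterlim (\<lambda>j. t / 2 ^ j) (at_right 0) sequentially"
      using t by real_asymp
    from filterlim_compose[OF small this]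
    have "(\<lambda>j. t / 2 ^ j * U (t / 2 ^ j)) \<longlonglongrightarrow> 0" .
    then have "(\<lambda>j. \<bar>t / 2 ^ j * U (t / 2 ^ j)\<bar> / t + \<epsilon> / 2) \<longlonglongrightarrow> \<bar>0\<bar> / t + \<epsilon> / 2"
      using t by (intro tendsto_intros) auto
    moreover have "\<bar>t / 2 ^ j * U (t / 2 ^ j)\<bar> / t = \<bar>U (t / 2 ^ j)\<bar> / 2 ^ j" for j
      using t by (simp add: abs_mult)
    ultimately have "(\<lambda>j. \<bar>U (t / 2 ^ j)\<bar> / 2 ^ j + \<epsilon> / 2) \<longlonglongrightarrow> \<epsilon> / 2" by simp
    then have "\<bar>U t\<bar> \<le> \<epsilon> / 2" by (rule LIMSEQ_le_const) (use iter in auto)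
    then show ?thesis using e by simp
  qed
  then show "\<forall>\<^sub>F x in at_right 0. dist (U x) 0 < \<epsilon>"
    unfolding eventually_at_right_field using \<delta>(1) by auto
qed

lemma log_gf_expansion:
  "((\<lambda>s. log_gf s - pi\<^sup>2 / (4 * s) - ln s / 2) \<longlongrightarrow> - ln 2 - ln pi / 2) (at_right (0::real))"
proof -
  \<comment> \<open>Forming \<open>U s - 2 * U (2 * s)\<close> cancels the \<open>1 / s\<close>
    term, turns \<open>- ln s / 2\<close> into \<open>ln s / 2 + ln 2\<close> and negates constants,
    so \<open>log_gf_doubling_tendsto\<close> dictates the constant.\<close>
  define U where "U s = log_gf s - pi\<^sup>2 / (4 * s) - ln s / 2 + ln 2 + ln pi / 2" for s :: real
  have "(U \<longlongrightarrow> 0) (at_right 0)"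
  proof (rule tendsto_0_of_doubling)
    have "((\<lambda>s. log_gf s - 2 * log_gf (2 * s) + ln s / 2 - ln pi / 2) \<longlongrightarrow> ln pi / 2 - ln pi / 2) (at_right (0::real))"
      by (intro tendsto_diff log_gf_doubling_tendsto tendsto_const)
    then show "((\<lambda>s. U s - 2 * U (2 * s)) \<longlongrightarrow> 0) (at_right 0)"
    proof (rule Lim_transform_eventually[THEN tendsto_eq_rhs])
      show "\<forall>\<^sub>F s in at_right 0. log_gf s - 2 * log_gf (2 * s) + ln s / 2 - ln pi / 2 = U s - 2 * U (2 * s)"
        using eventually_at_right_less[of 0]
        by eventually_elim (simp add: U_def ln_mult_pos field_simps)
    qed simp
    have "((\<lambda>s. s * log_gf s - pi\<^sup>2 / 4 + s * (- ln s / 2 + ln 2 + ln pi / 2)) \<longlongrightarrow> pi\<^sup>2 / 4 - pi\<^sup>2 / 4 + 0) (at_right (0::real))"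
      by (intro tendsto_add tendsto_diff log_gf_leading_order tendsto_const) real_asymp
    then show "((\<lambda>s. s * U s) \<longlongrightarrow> 0) (at_right 0)"
    proof (rule Lim_transform_eventually[THEN tendsto_eq_rhs])
      show "\<forall>\<^sub>F s in at_right 0. s * log_gf s - pi\<^sup>2 / 4 + s * (- ln s / 2 + ln 2 + ln pi / 2) = s * U s"
        using eventually_at_right_less[of 0]
        by eventually_elim (simp add: U_def field_simps)
    qed simp
  qed
  then have "((\<lambda>s. U s + (- ln 2 - ln pi / 2)) \<longlongrightarrow> 0 + (- ln 2 - ln pi / 2)) (at_right 0)"
    by (intro tendsto_intros)
  moreover have "U s + (- ln 2 - ln pi / 2) = log_gf s - pi\<^sup>2 / (4 * s) - ln s / 2" for s
    unfolding U_def by linarith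
  ultimately show ?thesis by simp
qed

section \<open>Behaviour near the saddle point\<close>

lemma one_minus_cos_ge:
  fixes \<theta> :: real
  assumes "\<bar>\<theta>\<bar> \<le> pi"
  shows "\<theta>\<^sup>2 / 18 \<le> 1 - cos \<theta>"
proof -
  define x where "x = \<bar>\<theta>\<bar> / 2"
  have x: "0 \<le> x" "x \<le> 2" using assms pi_less_4 by (auto simp: x_def)
  have "\<bar>sin x - (\<Sum>m<3. sin_coeff m * x ^ m)\<bar> \<le> inverse (fact 3) * \<bar>x\<bar> ^ 3"
    by (rule Maclaurin_sin_bound)
  moreover have "(\<Sum>m<3. sin_coeff m * x ^ m) = x"
    by (simp add: sin_coeff_def eval_nat_numeral)
  ultimately have "\<bar>sin x - x\<bar> \<le> x ^ 3 / 6" using x by (simp add: fact_numeral)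
  then have "x - sin x \<le> x ^ 3 / 6" by linarith
  moreover have "x * (x * x) \<le> x * (2 * 2)" using x by (intro mult_mono) auto
  \<comment> \<open>For \<open>x \<le> 2\<close> the cubic remainder is at most
    \<open>2 * x / 3\<close>. The constant 18 arises as
    \<open>2 * (x / 3)\<^sup>2 = \<theta>\<^sup>2 / 18\<close>.\<close>
  ultimately have "x / 3 \<le> sin x" by (simp add: power3_eq_cube)
  then have "(x / 3)\<^sup>2 \<le> (sin x)\<^sup>2" using x by (intro power_mono) auto
  moreover have "cos \<theta> = 1 - 2 * (sin x)\<^sup>2"
    using cos_double_sin[of x] by (simp add: x_def)
  moreover have "x\<^sup>2 = \<theta>\<^sup>2 / 4" by (simp add: x_def power_divide)
  ultimately show ?thesis by (simp add: power_divide)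
qed

lemma geometric_Re_deficit:
  fixes r \<theta> :: real
  assumes "0 < r" "r < 1"
  defines "u \<equiv> r * (1 - cos \<theta>)"
  shows "1 / (1 - r) - Re (1 / (1 - of_real r * cis \<theta>)) =
           u * (1 + r) / ((1 - r) * ((1 - r)\<^sup>2 + 2 * u))"
proof -
  have "u \<ge> 0" unfolding u_def using assms by simp
  then have pos: "(1 - r)\<^sup>2 + 2 * u > 0" using assms by (intro add_pos_nonneg) auto
  have den: "(1 - r * cos \<theta>)\<^sup>2 + (r * sin \<theta>)\<^sup>2 = (1 - r)\<^sup>2 + 2 * u"
  proof -
    have "(1 - r * cos \<theta>)\<^sup>2 + (r * sin \<theta>)\<^sup>2 = 1 - 2 * r * cos \<theta> + r\<^sup>2 * ((sin \<theta>)\<^sup>2 + (cos \<theta>)\<^sup>2)"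
      unfolding power2_eq_square by (simp only: algebra_simps)
    also have "(sin \<theta>)\<^sup>2 + (cos \<theta>)\<^sup>2 = 1" by (rule sin_cos_squared_add)
    finally have "(1 - r * cos \<theta>)\<^sup>2 + (r * sin \<theta>)\<^sup>2 = 1 - 2 * r * cos \<theta> + r\<^sup>2" by simp
    then show ?thesis by (simp add: u_def power2_eq_square algebra_simps)
  qed
  have "Re (1 / (1 - of_real r * cis \<theta>)) = (1 - r * cos \<theta>) / ((1 - r)\<^sup>2 + 2 * u)"
    unfolding den[symmetric] by (simp add: Re_divide)
  also have "1 - r * cos \<theta> = (1 - r) + u" by (simp add: u_def algebra_simps)
  finally have Re: "Re (1 / (1 - of_real r * cis \<theta>)) = ((1 - r) + u) / ((1 - r)\<^sup>2 + 2 * u)" .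
  have "1 / (1 - r) - ((1 - r) + u) / ((1 - r)\<^sup>2 + 2 * u) =
      (((1 - r)\<^sup>2 + 2 * u) - (1 - r) * ((1 - r) + u)) / ((1 - r) * ((1 - r)\<^sup>2 + 2 * u))"
    using pos assms by (simp add: diff_frac_eq)
  also have "((1 - r)\<^sup>2 + 2 * u) - (1 - r) * ((1 - r) + u) = u * (1 + r)"
    by (simp add: power2_eq_square algebra_simps)
  finally show ?thesis unfolding Re .
qed

text \<open>Leaving the real axis cannot increase the real part of any term, because
  \<open>norm (exp w - 1) \<ge> exp (Re w) - 1\<close>. So the loss of the term \<open>j = 0\<close>
  alone bounds that of the series. The sign in \<open>Complex s (- \<theta>)\<close> makes
  \<open>exp (- z)\<close> equal to \<open>exp (- s) * cis \<theta>\<close>.\<close>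

lemma log_gf_Re_deficit:
  fixes s \<theta> :: real
  assumes "s > 0"
  shows "Re (log_gf (Complex s (- \<theta>))) - log_gf s
           \<le> - 2 * (1 / (1 - exp (- s)) - Re (1 / (1 - of_real (exp (- s)) * cis \<theta>)))"
proof -
  define z where "z = Complex s (- \<theta>)"
  have Rez: "Re z = s" by (simp add: z_def)
  define t where "t j = 2 / (of_nat (2 * j + 1) * (exp (of_nat (2 * j + 1) * s) - 1))
      - Re (2 / (of_nat (2 * j + 1) * (exp (of_nat (2 * j + 1) * z) - 1)))" for j
  have "t sums (log_gf s - Re (log_gf z))"
    unfolding t_def using assms
    by (intro sums_diff sums_Re sums_log_gf_real(1) sums_log_gf_complex) (simp_all add: Rez)
  moreover have nonneg: "0 \<le> t j" for j
  proof -
    define m where "m = real (2 * j + 1)"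
    have m: "m > 0" by (simp add: m_def)
    have E: "0 < exp (m * s) - 1" using m assms by simp
    have le: "exp (m * s) - 1 \<le> norm (exp (of_nat (2 * j + 1) * z) - 1)"
      using norm_exp_minus_1_ge[of "of_nat (2 * j + 1) * z"] by (simp add: m_def Rez)
    have "Re (2 / (of_nat (2 * j + 1) * (exp (of_nat (2 * j + 1) * z) - 1)))
        \<le> norm (2 / (of_nat (2 * j + 1) * (exp (of_nat (2 * j + 1) * z) - 1)))"
      by (rule complex_Re_le_cmod)
    also have "\<dots> = 2 / (m * norm (exp (of_nat (2 * j + 1) * z) - 1))"
      by (simp add: norm_divide norm_mult m_def del: of_nat_mult of_nat_add of_nat_Suc)
    also have "\<dots> \<le> 2 / (m * (exp (m * s) - 1))"
      using le m E by (intro divide_left_mono mult_left_mono mult_pos_pos) auto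
    finally show ?thesis by (simp add: t_def m_def)
  qed
  ultimately have "sum t {0} \<le> log_gf s - Re (log_gf z)"
    using sum_le_suminf[of t "{0}"] by (simp add: sums_iff)
  moreover have "t 0 = 2 * (1 / (1 - exp (- s)) - Re (1 / (1 - of_real (exp (- s)) * cis \<theta>)))"
  proof -
    have q: "exp z * (of_real (exp (- s)) * cis \<theta>) = 1"
    proof -
      have "of_real (exp (- s)) * cis \<theta> = exp (- z)"
        by (simp add: z_def exp_eq_polar)
      then show ?thesis by (simp add: exp_minus)
    qed
    define Q where "Q = of_real (exp (- s)) * cis \<theta>"
    have "norm Q < 1" using assms by (simp add: Q_def norm_mult)
    then have Q1: "1 - Q \<noteq> 0" by auto
    have Q0: "Q \<noteq> 0" by (simp add: Q_def)
    have ez: "exp z = 1 / Q" using q Q0 unfolding Q_def[symmetric] by (simp only: eq_divide_eq) simp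
    have e1: "2 / (exp z - 1) = 2 * (1 / (1 - Q)) - 2"
      unfolding ez using Q0 Q1 by (simp add: field_simps)
    define R where "R = exp (- s)"
    have R: "R > 0" "R < 1" using assms by (auto simp: R_def)
    have es: "exp s = 1 / R" by (simp add: R_def exp_minus field_simps)
    have e2: "2 / (exp s - 1) = 2 * (1 / (1 - R)) - 2"
      unfolding es using R by (simp add: field_simps)
    have "t 0 = 2 / (exp s - 1) - Re (2 / (exp z - 1))" by (simp add: t_def)
    also have "\<dots> = 2 * (1 / (1 - R)) - Re (2 * (1 / (1 - Q)))" unfolding e1 e2 by simp
    also have "Re (2 * (1 / (1 - Q))) = 2 * Re (1 / (1 - Q))"
    proof -
      have "Re (2 * w) = 2 * Re w" for w by simp
      then show ?thesis .
    qed
    finally show ?thesis unfolding Q_def R_def by (simp add: algebra_simps)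
  qed
  ultimately show ?thesis by (simp add: z_def)
qed

text \<open>\<open>s \<le> ln 2\<close> gives \<open>r \<ge> 1 / 2\<close>, hence
  \<open>u \<ge> \<theta>\<^sup>2 / 36\<close>. Once the factor \<open>1 + r \<ge> 1\<close> is
  dropped, the deficit increases with \<open>u\<close> and decreases with \<open>1 - r\<close>, so
  these may be replaced by \<open>\<theta>\<^sup>2 / 36\<close> and \<open>s\<close>.\<close>

lemma log_gf_Re_decay:
  fixes s \<theta> :: real
  assumes s: "s > 0" "s \<le> ln 2" and \<theta>: "\<bar>\<theta>\<bar> \<le> pi"
  shows "Re (log_gf (Complex s (- \<theta>))) - log_gf s \<le> - (\<theta>\<^sup>2 / (s * (18 * s\<^sup>2 + \<theta>\<^sup>2)))"
proof -
  define r where "r = exp (- s)"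
  define u where "u = r * (1 - cos \<theta>)"
  define v where "v = \<theta>\<^sup>2 / 36"
  have r: "0 < r" "r < 1" using s by (auto simp: r_def)
  have r2: "1 / 2 \<le> r"
  proof -
    have "exp (- ln 2) \<le> r" unfolding r_def using s by simp
    then show ?thesis by (simp add: exp_minus)
  qed
  have rs: "1 - r \<le> s" using exp_ge_add_one_self[of "- s"] by (simp add: r_def)
  have v0: "v \<ge> 0" by (simp add: v_def)
  have "1 / 2 * (\<theta>\<^sup>2 / 18) \<le> r * (1 - cos \<theta>)"
    using r2 one_minus_cos_ge[OF \<theta>] by (intro mult_mono) auto
  then have uv: "v \<le> u" by (simp add: u_def v_def)
  have pos: "(1 - r) * ((1 - r)\<^sup>2 + 2 * w) > 0" if "w \<ge> 0" for w
    using r that by (intro mult_pos_pos add_pos_nonneg) auto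
  have "v / (s * (s\<^sup>2 + 2 * v)) \<le> v / ((1 - r) * ((1 - r)\<^sup>2 + 2 * v))"
  proof (rule divide_left_mono[OF _ v0])
    show "(1 - r) * ((1 - r)\<^sup>2 + 2 * v) \<le> s * (s\<^sup>2 + 2 * v)"
      using rs r s v0 by (intro mult_mono add_mono power_mono) auto
    show "0 < s * (s\<^sup>2 + 2 * v) * ((1 - r) * ((1 - r)\<^sup>2 + 2 * v))"
      using s v0 pos[OF v0] by (intro mult_pos_pos[OF mult_pos_pos] add_pos_nonneg) auto
  qed
  also have "\<dots> \<le> u / ((1 - r) * ((1 - r)\<^sup>2 + 2 * u))"
  proof -
    have "v * ((1 - r) * ((1 - r)\<^sup>2 + 2 * u)) \<le> u * ((1 - r) * ((1 - r)\<^sup>2 + 2 * v))"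
    proof -
      have "v * ((1 - r) * (1 - r)\<^sup>2) \<le> u * ((1 - r) * (1 - r)\<^sup>2)"
        using uv r by (intro mult_right_mono) auto
      then show ?thesis by (simp add: algebra_simps)
    qed
    then show ?thesis using pos[OF v0] pos[of u] uv v0
      by (subst frac_le_eq) (auto simp: divide_le_0_iff mult_less_0_iff intro: mult_pos_pos)
  qed
  also have "\<dots> \<le> u * (1 + r) / ((1 - r) * ((1 - r)\<^sup>2 + 2 * u))"
    using pos[of u] uv v0 r by (intro divide_right_mono) (auto simp: algebra_simps)
  also have "\<dots> = 1 / (1 - r) - Re (1 / (1 - of_real r * cis \<theta>))"
    unfolding u_def by (rule geometric_Re_deficit[OF r, symmetric])
  finally have 1: "v / (s * (s\<^sup>2 + 2 * v)) \<le> 1 / (1 - r) - Re (1 / (1 - of_real r * cis \<theta>))" .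
  have 2: "2 * (v / (s * (s\<^sup>2 + 2 * v))) = \<theta>\<^sup>2 / (s * (18 * s\<^sup>2 + \<theta>\<^sup>2))"
  proof -
    have "s * (s\<^sup>2 + 2 * v) = s * (18 * s\<^sup>2 + \<theta>\<^sup>2) / 18" by (simp add: v_def field_simps)
    then show ?thesis by (simp add: v_def)
  qed
  have "Re (log_gf (Complex s (- \<theta>))) - log_gf s \<le> - 2 * (1 / (1 - r) - Re (1 / (1 - of_real r * cis \<theta>)))"
    unfolding r_def by (rule log_gf_Re_deficit[OF s(1)])
  also have "\<dots> \<le> - 2 * (v / (s * (s\<^sup>2 + 2 * v)))"
    using 1 by (intro mult_left_mono_neg) auto
  also have "\<dots> = - (\<theta>\<^sup>2 / (s * (18 * s\<^sup>2 + \<theta>\<^sup>2)))" using 2 by simp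
  finally show ?thesis .
qed

text \<open>The cube is the power that the saddle requires: the exponent below is
  \<open>X = t\<^sup>2 / (18 + s * t\<^sup>2)\<close>, which saturates at \<open>1 / s\<close>, and
  only \<open>s ^ 3\<close> is known to be at most \<open>16 / t\<^sup>2\<close>.\<close>

lemma exp_minus_le_cube:
  fixes X :: real
  assumes "X > 0"
  shows "exp (- X) \<le> 27 * (1 / X) ^ 3"
proof -
  have "(X / 3) ^ 3 \<le> (1 + X / 3) ^ 3" using assms by (intro power_mono) auto
  also have "\<dots> \<le> exp X" using exp_ge_one_plus_x_over_n_power_n[of 3 X] assms by simp
  finally have "X ^ 3 / 27 \<le> exp X" by (simp add: power_divide)
  then show ?thesis using assms by (simp add: exp_minus field_simps)
qed

lemma cube_add_le:
  fixes a b :: real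
  assumes "a \<ge> 0" "b \<ge> 0"
  shows "(a + b) ^ 3 \<le> 4 * (a ^ 3 + b ^ 3)"
proof -
  have "4 * (a ^ 3 + b ^ 3) - (a + b) ^ 3 = 3 * (a + b) * (a - b)\<^sup>2"
    by (simp add: power2_eq_square power3_eq_cube algebra_simps)
  also have "\<dots> \<ge> 0" using assms by simp
  finally show ?thesis by simp
qed

text \<open>The scale \<open>s * sqrt s\<close> is the width of the saddle at \<open>s\<close>.\<close>

lemma log_gf_scaled_decay:
  fixes s t :: real
  assumes s: "s > 0" "s \<le> ln 2" and t: "\<bar>s * sqrt s * t\<bar> \<le> pi"
  shows "exp (Re (log_gf (Complex s (- (s * sqrt s * t)))) - log_gf s) \<le> 1263168 / (1 + t\<^sup>2)"
proof -
  define \<theta> where "\<theta> = s * sqrt s * t"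
  define Y where "Y = Re (log_gf (Complex s (- \<theta>))) - log_gf s"
  have \<theta>2: "\<theta>\<^sup>2 = s ^ 3 * t\<^sup>2"
    using s by (simp add: \<theta>_def power_mult_distrib power2_eq_square power3_eq_cube)
  have Y: "Y \<le> - (\<theta>\<^sup>2 / (s * (18 * s\<^sup>2 + \<theta>\<^sup>2)))"
    unfolding Y_def using s t by (intro log_gf_Re_decay) (auto simp: \<theta>_def)
  have "exp Y \<le> 1263168 / (1 + t\<^sup>2)"
  proof (cases "t\<^sup>2 \<le> 1")
    case True
    have "0 \<le> \<theta>\<^sup>2 / (s * (18 * s\<^sup>2 + \<theta>\<^sup>2))" using s by simp
    then have "exp Y \<le> 1" using Y by simp
    also have "1 \<le> 1263168 / (1 + t\<^sup>2)" using True by (simp add: field_simps add_pos_nonneg)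
    finally show ?thesis .
  next
    case False
    define X where "X = t\<^sup>2 / (18 + s * t\<^sup>2)"
    have t1: "1 < t\<^sup>2" using False by simp
    have p: "18 + s * t\<^sup>2 > 0" using s by (simp add: add_pos_nonneg)
    have X: "X > 0" unfolding X_def using t1 p by (intro divide_pos_pos) auto
    have "\<theta>\<^sup>2 / (s * (18 * s\<^sup>2 + \<theta>\<^sup>2)) = (s ^ 3 * t\<^sup>2) / (s ^ 3 * (18 + s * t\<^sup>2))"
      unfolding \<theta>2 by (simp add: power2_eq_square power3_eq_cube algebra_simps)
    also have "\<dots> = X" unfolding X_def using s by simp
    finally have "Y \<le> - X" using Y by simp
    then have "exp Y \<le> exp (- X)" by simp
    also have "\<dots> \<le> 27 * (1 / X) ^ 3" by (rule exp_minus_le_cube[OF X])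
    also have "1 / X = 18 / t\<^sup>2 + s"
    proof -
      have "t\<^sup>2 \<noteq> 0" using t1 by linarith
      then show ?thesis unfolding X_def by (simp add: add_divide_distrib)
    qed
    also have "(18 / t\<^sup>2 + s) ^ 3 \<le> 4 * ((18 / t\<^sup>2) ^ 3 + s ^ 3)"
      using s by (intro cube_add_le) auto
    finally have "exp Y \<le> 108 * ((18 / t\<^sup>2) ^ 3 + s ^ 3)" by simp
    also have "(18 / t\<^sup>2) ^ 3 + s ^ 3 \<le> 5848 / t\<^sup>2"
    proof -
      have "(18 / t\<^sup>2) ^ 3 = 5832 / (t\<^sup>2 * (t\<^sup>2 * t\<^sup>2))" by (simp add: power_divide power3_eq_cube)
      also have "\<dots> \<le> 5832 / (t\<^sup>2 * (1 * 1))"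
        using t1 by (intro divide_left_mono mult_left_mono mult_mono mult_pos_pos) auto
      finally have 1: "(18 / t\<^sup>2) ^ 3 \<le> 5832 / t\<^sup>2" by simp
      \<comment> \<open>The arc condition \<open>\<bar>\<theta>\<bar> \<le> pi < 4\<close> reads
        \<open>s ^ 3 * t\<^sup>2 \<le> 16\<close> in the scaled variable.\<close>
      have "\<theta>\<^sup>2 \<le> 4\<^sup>2"
        using t pi_less_4 by (intro abs_le_square_iff[THEN iffD1]) (simp add: \<theta>_def)
      then have "s ^ 3 \<le> 16 / t\<^sup>2" unfolding \<theta>2 using t1 by (subst pos_le_divide_eq) auto
      with 1 show ?thesis by (simp add: add_divide_distrib[symmetric] field_simps)
    qed
    \<comment> \<open>Here \<open>108 = 27 * 4\<close> stems from the two cube estimates and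
      \<open>5848 = 18 ^ 3 + 16\<close>; the final constant is \<open>2 * 108 * 5848\<close>, by
      \<open>1 + t\<^sup>2 \<le> 2 * t\<^sup>2\<close>.\<close>
    also have "108 * (5848 / t\<^sup>2) \<le> 1263168 / (1 + t\<^sup>2)"
    proof -
      have "108 * (5848 / t\<^sup>2) = 1263168 / (t\<^sup>2 + t\<^sup>2)" by simp
      also have "\<dots> \<le> 1263168 / (1 + t\<^sup>2)"
        using t1 by (intro divide_left_mono mult_pos_pos add_mono add_pos_pos) auto
      finally show ?thesis .
    qed
    finally show ?thesis by simp
  qed
  then show ?thesis by (simp add: Y_def \<theta>_def)
qed

section \<open>The series without its poles, near the saddle\<close>

definition bose_reg :: "complex \<Rightarrow> complex" where
  "bose_reg w = 1 / (exp w - 1) - 1 / w"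

lemma bose_reg_deriv:
  assumes "Re w > 0"
  shows "(bose_reg has_field_derivative (1 / w\<^sup>2 - 1 / (exp w + exp (- w) - 2))) (at w within S)"
proof -
  have w: "w \<noteq> 0" using assms by auto
  have "norm (exp w) \<noteq> 1" using assms by simp
  then have e: "exp w - 1 \<noteq> 0" by (metis norm_one right_minus_eq)
  have eq: "exp w + exp (- w) - 2 = (exp w - 1)\<^sup>2 / exp w"
    by (simp add: exp_minus power2_eq_square field_simps)
  have "(bose_reg has_field_derivative (- exp w / (exp w - 1)\<^sup>2 + 1 / w\<^sup>2)) (at w within S)"
    unfolding bose_reg_def[abs_def] using w e
    by (auto intro!: derivative_eq_intros simp: power2_eq_square)
  then show ?thesis unfolding eq using e by (simp add: field_simps)
qed

text \<open>In this sector \<open>norm w\<close> is comparable with \<open>Re w\<close>. Near 0 the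
  two double poles cancel and leave a bounded function; for \<open>Re w > 1\<close> each summand
  alone is at most \<open>1 / (Re w)\<^sup>2\<close>.\<close>

lemma bose_reg_deriv_bound:
  assumes x: "Re w > 0" and y: "\<bar>Im w\<bar> \<le> Re w"
  shows "norm (1 / w\<^sup>2 - 1 / (exp w + exp (- w) - 2)) \<le> 4 / (1 + (Re w)\<^sup>2)"
proof -
  define x where "x = Re w"
  define E where "E = exp w + exp (- w) - 2"
  have x0: "x > 0" using x by (simp add: x_def)
  have wx: "x\<^sup>2 \<le> (norm w)\<^sup>2"
    unfolding x_def cmod_power2 by simp
  have wx2: "(norm w)\<^sup>2 \<le> 2 * x\<^sup>2"
    using y abs_le_square_iff[of "Im w" "Re w"] x unfolding x_def cmod_power2 by simp
  \<comment> \<open>\<open>norm E \<ge> (exp x - 1)\<^sup>2 / exp x = (2 * sinh (x /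
    2))\<^sup>2\<close>, and \<open>sinh (x / 2) \<ge> x / 2\<close>.\<close>
  have Ex: "x\<^sup>2 \<le> norm E"
  proof -
    have "E = (exp w - 1)\<^sup>2 / exp w"
      unfolding E_def by (simp add: exp_minus power2_eq_square field_simps)
    then have nE: "norm E = (norm (exp w - 1))\<^sup>2 / exp x"
      by (simp add: norm_divide norm_power x_def)
    have "x * exp (x / 2) \<le> exp x - 1"
    proof -
      have "(exp (x / 2) - exp (- (x / 2)) - x) * exp (x / 2) = exp x - 1 - x * exp (x / 2)"
        by (simp add: left_diff_distrib flip: exp_add)
      moreover have "0 \<le> (exp (x / 2) - exp (- (x / 2)) - x) * exp (x / 2)"
        using real_le_x_sinh[of "x / 2"] x0 by (intro mult_nonneg_nonneg) (auto simp: exp_minus)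
      ultimately show ?thesis by linarith
    qed
    then have "(x * exp (x / 2))\<^sup>2 \<le> (norm (exp w - 1))\<^sup>2"
      using norm_exp_minus_1_ge[of w] x0 unfolding x_def[symmetric] by (intro power_mono) auto
    then have "x\<^sup>2 * exp x \<le> (norm (exp w - 1))\<^sup>2"
      by (simp add: power_mult_distrib exp_double[symmetric])
    then show ?thesis unfolding nE by (simp add: pos_le_divide_eq)
  qed
  have E0: "E \<noteq> 0" and w0: "w \<noteq> 0" using Ex wx x0 by auto
  show ?thesis
  proof (cases "x \<le> 1")
    case True
    have T: "norm (exp u - (1 + u + u\<^sup>2 / 2 + u ^ 3 / 6)) \<le> (norm u) ^ 4 / 2" if "\<bar>Re u\<bar> \<le> 1" for u :: complex
    proof -
      have "norm (exp u - (\<Sum>k\<le>3. u ^ k / fact k)) \<le> exp \<bar>Re u\<bar> * norm u ^ Suc 3 / fact 3"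
        by (rule Taylor_exp)
      also have "(\<Sum>k\<le>3. u ^ k / fact k) = 1 + u + u\<^sup>2 / 2 + u ^ 3 / 6"
        by (simp add: eval_nat_numeral fact_numeral)
      also have "exp \<bar>Re u\<bar> * norm u ^ Suc 3 / fact 3 \<le> 3 * norm u ^ Suc 3 / fact 3"
      proof (intro divide_right_mono mult_right_mono)
        have "exp \<bar>Re u\<bar> \<le> exp 1" using that by simp
        then show "exp \<bar>Re u\<bar> \<le> 3" using exp_le by linarith
      qed auto
      finally show ?thesis by (simp add: fact_numeral)
    qed
    \<comment> \<open>Adding the cubic Taylor polynomials at \<open>w\<close> and \<open>- w\<close>
      cancels the odd terms, so only remainders of order four are left.\<close>
    have "E - w\<^sup>2 = (exp w - (1 + w + w\<^sup>2 / 2 + w ^ 3 / 6)) + (exp (- w) - (1 + (- w) + (- w)\<^sup>2 / 2 + (- w) ^ 3 / 6))"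
      by (simp add: E_def field_simps)
    also have "norm \<dots> \<le> norm w ^ 4 / 2 + norm (- w) ^ 4 / 2"
      using True x0 by (intro norm_triangle_le add_mono T) (auto simp: x_def)
    finally have d: "norm (E - w\<^sup>2) \<le> norm w ^ 4" by simp
    have "1 / w\<^sup>2 - 1 / E = (E - w\<^sup>2) / (w\<^sup>2 * E)" using E0 w0 by (simp add: diff_frac_eq)
    then have "norm (1 / w\<^sup>2 - 1 / E) = norm (E - w\<^sup>2) / ((norm w)\<^sup>2 * norm E)"
      by (simp add: norm_divide norm_mult norm_power)
    also have "\<dots> \<le> norm w ^ 4 / ((norm w)\<^sup>2 * x\<^sup>2)"
      using d Ex x0 w0 by (intro frac_le mult_left_mono) auto
    also have "\<dots> = (norm w)\<^sup>2 / x\<^sup>2" using w0 by (simp add: power2_eq_square power4_eq_xxxx)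
    also have "\<dots> \<le> 2" using wx2 x0 by (simp add: divide_le_eq)
    also have "2 \<le> 4 / (1 + x\<^sup>2)" using True x0 by (simp add: field_simps add_pos_nonneg power_le_one)
    finally show ?thesis by (simp add: E_def x_def)
  next
    case False
    have "norm (1 / w\<^sup>2 - 1 / E) \<le> norm (1 / w\<^sup>2) + norm (1 / E)" by (rule norm_triangle_ineq4)
    also have "\<dots> = 1 / (norm w)\<^sup>2 + 1 / norm E" by (simp add: norm_divide norm_power)
    also have "\<dots> \<le> 1 / x\<^sup>2 + 1 / x\<^sup>2"
      using wx Ex x0 by (intro add_mono divide_left_mono mult_pos_pos) (use w0 E0 in auto)
    also have "\<dots> \<le> 4 / (1 + x\<^sup>2)"
    proof -
      have "1 \<le> x\<^sup>2" using False by simp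
      then show ?thesis using x0 by (simp add: field_simps add_pos_nonneg)
    qed
    finally show ?thesis by (simp add: E_def x_def)
  qed
qed

lemma bose_reg_diff_bound:
  assumes x: "x > 0" and y: "\<bar>y\<bar> \<le> x"
  shows "norm (bose_reg (Complex x y) - bose_reg (of_real x)) \<le> 4 / (1 + x\<^sup>2) * \<bar>y\<bar>"
proof -
  define S where "S = closed_segment (complex_of_real x) (Complex x y)"
  have S: "Re w = x \<and> \<bar>Im w\<bar> \<le> x" if "w \<in> S" for w
  proof -
    have "\<exists>u\<ge>0. u \<le> 1 \<and> w = (1 - u) *\<^sub>R complex_of_real x + u *\<^sub>R Complex x y"
      using that by (simp only: S_def in_segment)
    then obtain u where u: "0 \<le> u" "u \<le> 1" and w: "w = (1 - u) *\<^sub>R complex_of_real x + u *\<^sub>R Complex x y"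
      by (elim exE conjE)
    have "\<bar>u * y\<bar> \<le> 1 * x" unfolding abs_mult using u y x by (intro mult_mono) auto
    moreover have "Re w = (1 - u) * x + u * x" "Im w = u * y" using w by simp_all
    ultimately show ?thesis by (simp add: left_diff_distrib)
  qed
  have "norm (bose_reg (Complex x y) - bose_reg (of_real x)) \<le> 4 / (1 + x\<^sup>2) * norm (Complex x y - of_real x)"
  proof (rule field_differentiable_bound[where S = S])
    show "(bose_reg has_field_derivative (1 / w\<^sup>2 - 1 / (exp w + exp (- w) - 2))) (at w within S)"
      if "w \<in> S" for w
      using S[OF that] x by (intro bose_reg_deriv) simp
    show "norm (1 / w\<^sup>2 - 1 / (exp w + exp (- w) - 2)) \<le> 4 / (1 + x\<^sup>2)" if "w \<in> S" for w
      using bose_reg_deriv_bound[of w] S[OF that] x by simp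
  qed (auto simp: S_def)
  also have "Complex x y - of_real x = \<i> * of_real y" by (simp add: complex_eq_iff)
  finally show ?thesis by (simp add: norm_mult)
qed

text \<open>The pole removed in \<open>bose_reg\<close> contributes
  \<open>2 / (m\<^sup>2 * z)\<close> for each odd \<open>m\<close>, in total
  \<open>pi\<^sup>2 / (4 * z)\<close>.\<close>

lemma sums_log_gf_regular:
  assumes "Re z > 0"
  shows "(\<lambda>j. 2 / of_nat (2 * j + 1) * bose_reg (of_nat (2 * j + 1) * z)) sums
           (log_gf z - of_real (pi\<^sup>2) / (4 * z))"
proof -
  have z: "z \<noteq> 0" using assms by auto
  have "(\<lambda>j. of_real (1 / real (2 * j + 1) ^ 2)) sums (of_real (pi\<^sup>2 / 8) :: complex)"
    by (rule sums_of_real[OF odd_inverse_squares_sums])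
  from sums_mult[OF this, of "2 / z"]
  have "(\<lambda>j. 2 / z * of_real (1 / real (2 * j + 1) ^ 2)) sums (2 / z * of_real (pi\<^sup>2 / 8))" .
  from sums_diff[OF sums_log_gf_complex[OF assms] this]
  have "(\<lambda>j. 2 / (of_nat (2 * j + 1) * (exp (of_nat (2 * j + 1) * z) - 1)) - 2 / z * of_real (1 / real (2 * j + 1) ^ 2))
      sums (log_gf z - 2 / z * of_real (pi\<^sup>2 / 8))" .
  moreover have "2 / (of_nat (2 * j + 1) * (exp (of_nat (2 * j + 1) * z) - 1)) - 2 / z * of_real (1 / real (2 * j + 1) ^ 2)
      = 2 / of_nat (2 * j + 1) * bose_reg (of_nat (2 * j + 1) * z)" for j
  proof -
    define m :: complex where "m = of_nat (2 * j + 1)"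
    have m: "m \<noteq> 0" unfolding m_def by (simp only: of_nat_eq_0_iff)
    have "of_real (1 / real (2 * j + 1) ^ 2) = 1 / m\<^sup>2" by (simp add: m_def)
    then show ?thesis unfolding m_def[symmetric] bose_reg_def
      using m z by (simp add: power2_eq_square right_diff_distrib)
  qed
  moreover have "2 / z * of_real (pi\<^sup>2 / 8) = of_real (pi\<^sup>2) / (4 * z)" by simp
  ultimately show ?thesis by simp
qed

text \<open>The displacement of \<open>m * z\<close> grows with \<open>m\<close>, but the factor
  \<open>2 / m\<close> absorbs this, so each term changes by at most
  \<open>8 * \<bar>t\<bar> * s powr (3/2) / (1 + (m * s)\<^sup>2)\<close>. This tends to 0 for fixed
  \<open>m\<close> and has a summable majorant of order \<open>m powr (-3/2)\<close>.\<close>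

lemma log_gf_regular_tendsto:
  fixes t :: real
  defines "z \<equiv> \<lambda>s. Complex s (- (s * sqrt s * t))"
  shows "((\<lambda>s. (log_gf (z s) - of_real (pi\<^sup>2) / (4 * z s)) -
            (log_gf (complex_of_real s) - of_real (pi\<^sup>2) / (4 * of_real s))) \<longlongrightarrow> 0) (at_right 0)"
proof -
  define a where "a j s = 2 / of_nat (2 * j + 1) * bose_reg (of_nat (2 * j + 1) * z s)
      - 2 / of_nat (2 * j + 1) * bose_reg (of_nat (2 * j + 1) * complex_of_real s)" for j s
  \<comment> \<open>The slope of \<open>m * z s\<close> is \<open>sqrt s * t\<close> up to sign, so
    this puts all \<open>m\<close> into the sector of \<open>bose_reg_deriv_bound\<close> at
    once.\<close>
  have ev: "\<forall>\<^sub>F s in at_right (0::real). sqrt s * \<bar>t\<bar> < 1"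
    by real_asymp
  have bound: "norm (a j s) \<le> 8 * \<bar>t\<bar> * (s * sqrt s / (1 + (real (2 * j + 1) * s)\<^sup>2))"
    if s: "0 < s" and small: "sqrt s * \<bar>t\<bar> < 1" for j s
  proof -
    define m where "m = real (2 * j + 1)"
    have m: "m > 0" by (simp add: m_def)
    have mz: "of_nat (2 * j + 1) * z s = Complex (m * s) (- (m * s * (sqrt s * t)))"
      by (simp add: complex_eq_iff z_def m_def algebra_simps)
    have ms: "of_nat (2 * j + 1) * complex_of_real s = of_real (m * s)" by (simp add: m_def)
    have "\<bar>m * s * (sqrt s * t)\<bar> \<le> m * s * 1"
      unfolding abs_mult using m s small by (intro mult_mono) (auto simp: abs_mult)
    then have "norm (bose_reg (of_nat (2 * j + 1) * z s) - bose_reg (of_nat (2 * j + 1) * complex_of_real s))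
        \<le> 4 / (1 + (m * s)\<^sup>2) * \<bar>- (m * s * (sqrt s * t))\<bar>"
      unfolding mz ms using m s by (intro bose_reg_diff_bound) auto
    then have "2 / m * norm (bose_reg (of_nat (2 * j + 1) * z s) - bose_reg (of_nat (2 * j + 1) * complex_of_real s))
        \<le> 2 / m * (4 / (1 + (m * s)\<^sup>2) * \<bar>- (m * s * (sqrt s * t))\<bar>)"
      using m by (intro mult_left_mono) auto
    also have "\<dots> = 8 * \<bar>t\<bar> * (s * sqrt s / (1 + (m * s)\<^sup>2))"
      using m s by (simp add: abs_mult)
    finally have le: "2 / m * norm (bose_reg (of_nat (2 * j + 1) * z s) - bose_reg (of_nat (2 * j + 1) * complex_of_real s))
        \<le> 8 * \<bar>t\<bar> * (s * sqrt s / (1 + (m * s)\<^sup>2))" .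
    have "norm (2 / of_nat (2 * j + 1) :: complex) = 2 / m"
      unfolding norm_divide norm_of_nat m_def by simp
    then have "norm (a j s) = 2 / m * norm (bose_reg (of_nat (2 * j + 1) * z s) - bose_reg (of_nat (2 * j + 1) * complex_of_real s))"
      unfolding a_def right_diff_distrib[symmetric] norm_mult by simp
    then show ?thesis using le unfolding m_def by simp
  qed
  \<comment> \<open>With \<open>x = m * s\<close> this is
    \<open>x powr (3/2) \<le> 1 + x\<^sup>2\<close>.\<close>
  have dom: "s * sqrt s / (1 + (m * s)\<^sup>2) \<le> 1 / (m * sqrt m)" if "0 < s" "0 < m" for s m :: real
  proof -
    define x where "x = m * s"
    have x: "x > 0" using that by (simp add: x_def)
    have "x * sqrt x \<le> 1 + x\<^sup>2"
    proof (cases "x \<le> 1")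
      case True
      then have "x * sqrt x \<le> 1 * 1" using x by (intro mult_mono) auto
      then show ?thesis by (smt (verit) zero_le_power2)
    next
      case False
      then have "sqrt x \<le> x" using x by (intro real_le_lsqrt) (auto simp: power2_eq_square)
      then have "x * sqrt x \<le> x * x" using x by (intro mult_left_mono) auto
      then show ?thesis by (simp add: power2_eq_square)
    qed
    then have "(s * sqrt s) * (m * sqrt m) \<le> 1 + (m * s)\<^sup>2"
      by (simp add: x_def real_sqrt_mult algebra_simps)
    moreover have "1 + (m * s)\<^sup>2 > 0" by (simp add: add_pos_nonneg)
    ultimately show ?thesis using that by (simp add: field_simps)
  qed
  have "((\<lambda>s. \<Sum>j. a j s) \<longlongrightarrow> (\<Sum>j::nat. 0)) (at_right 0)"
  proof (rule tannery)
    fix j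
    have "((\<lambda>s. 8 * \<bar>t\<bar> * (s * sqrt s / (1 + (real (2 * j + 1) * s)\<^sup>2))) \<longlongrightarrow> 0) (at_right 0)"
      by real_asymp
    moreover have "\<forall>\<^sub>F s in at_right 0. norm (a j s) \<le> 8 * \<bar>t\<bar> * (s * sqrt s / (1 + (real (2 * j + 1) * s)\<^sup>2))"
      using ev eventually_at_right_less[of 0] by eventually_elim (rule bound)
    ultimately show "((\<lambda>s. a j s) \<longlongrightarrow> 0) (at_right 0)"
      by (rule Lim_null_comparison[rotated])
  next
    show "summable (\<lambda>j. 8 * \<bar>t\<bar> * (1 / (real (Suc j) * sqrt (real (Suc j)))))"
    proof (rule summable_mult)
      have "summable (\<lambda>j. real (Suc j) powr (- 3 / 2))"
        by (subst summable_Suc_iff) (simp add: summable_real_powr_iff)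
      moreover have "real (Suc j) powr (- 3 / 2) = 1 / (real (Suc j) * sqrt (real (Suc j)))" for j
      proof -
        have "real (Suc j) powr (- 3 / 2) = 1 / real (Suc j) powr (1 + 1 / 2)"
          by (simp add: powr_minus_divide[symmetric])
        also have "real (Suc j) powr (1 + 1 / 2) = real (Suc j) * sqrt (real (Suc j))"
          by (subst powr_add) (simp add: powr_half_sqrt)
        finally show ?thesis .
      qed
      ultimately show "summable (\<lambda>j. 1 / (real (Suc j) * sqrt (real (Suc j))))" by simp
    qed
    show "\<forall>\<^sub>F s in at_right 0. \<forall>j. norm (a j s) \<le> 8 * \<bar>t\<bar> * (1 / (real (Suc j) * sqrt (real (Suc j))))"
      using ev eventually_at_right_less[of 0]
    proof eventually_elim
      case (elim s)
      show ?case
      proof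
        fix j
        have "norm (a j s) \<le> 8 * \<bar>t\<bar> * (s * sqrt s / (1 + (real (2 * j + 1) * s)\<^sup>2))"
          using elim by (intro bound) auto
        also have "\<dots> \<le> 8 * \<bar>t\<bar> * (1 / (real (2 * j + 1) * sqrt (real (2 * j + 1))))"
          using elim by (intro mult_left_mono dom) auto
        also have "\<dots> \<le> 8 * \<bar>t\<bar> * (1 / (real (Suc j) * sqrt (real (Suc j))))"
          by (intro mult_left_mono divide_left_mono mult_mono mult_pos_pos) auto
        finally show "norm (a j s) \<le> 8 * \<bar>t\<bar> * (1 / (real (Suc j) * sqrt (real (Suc j))))" .
      qed
    qed
  qed simp
  then have "((\<lambda>s. \<Sum>j. a j s) \<longlongrightarrow> 0) (at_right 0)" by simp
  moreover have "\<forall>\<^sub>F s in at_right 0. (\<Sum>j. a j s) = (log_gf (z s) - of_real (pi\<^sup>2) / (4 * z s)) -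
            (log_gf (complex_of_real s) - of_real (pi\<^sup>2) / (4 * of_real s))"
    using eventually_at_right_less[of 0]
  proof eventually_elim
    case (elim s)
    have "(\<lambda>j. a j s) sums ((log_gf (z s) - of_real (pi\<^sup>2) / (4 * z s)) -
            (log_gf (complex_of_real s) - of_real (pi\<^sup>2) / (4 * of_real s)))"
      unfolding a_def using elim by (intro sums_diff sums_log_gf_regular) (auto simp: z_def)
    then show ?case by (simp add: sums_iff)
  qed
  ultimately show ?thesis by (rule Lim_transform_eventually)
qed

text \<open>The linear term removes the tangent of \<open>pi\<^sup>2 / (4 * z)\<close> at
  \<open>s\<close>. For \<open>z = s * (1 - y)\<close> with \<open>y = \<i> * sqrt s * t\<close> the
  remainder is exactly \<open>(pi\<^sup>2 / 4) * y\<^sup>2 / (s * (1 - y))\<close>, and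
  \<open>y\<^sup>2 = - s * t\<^sup>2\<close> gives the Gaussian exponent.\<close>

lemma log_gf_saddle_tendsto:
  fixes t :: real
  defines "z \<equiv> \<lambda>s. Complex s (- (s * sqrt s * t))"
  shows "((\<lambda>s. log_gf (z s) - log_gf (complex_of_real s) + of_real (pi\<^sup>2 / (4 * s\<^sup>2)) * (z s - of_real s))
           \<longlongrightarrow> of_real (- (pi\<^sup>2 / 4) * t\<^sup>2)) (at_right 0)"
proof -
  have "((\<lambda>s. 1 / (1 - \<i> * of_real (sqrt s * t))) \<longlongrightarrow> 1 / (1 - \<i> * of_real 0)) (at_right 0)"
  proof (intro tendsto_intros)
    show "((\<lambda>s. sqrt s * t) \<longlongrightarrow> 0) (at_right 0)" by real_asymp
  qed simp
  note tendsto_mult_left[OF this, of "of_real (- (pi\<^sup>2 / 4) * t\<^sup>2)"]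
  from tendsto_add[OF log_gf_regular_tendsto[of t] this]
  have "((\<lambda>s. ((log_gf (z s) - of_real (pi\<^sup>2) / (4 * z s)) -
            (log_gf (complex_of_real s) - of_real (pi\<^sup>2) / (4 * of_real s))) +
      of_real (- (pi\<^sup>2 / 4) * t\<^sup>2) * (1 / (1 - \<i> * of_real (sqrt s * t)))) \<longlongrightarrow>
      of_real (- (pi\<^sup>2 / 4) * t\<^sup>2)) (at_right 0)"
    by (simp add: z_def)
  then show ?thesis
  proof (rule Lim_transform_eventually)
    show "\<forall>\<^sub>F s in at_right 0. ((log_gf (z s) - of_real (pi\<^sup>2) / (4 * z s)) -
            (log_gf (complex_of_real s) - of_real (pi\<^sup>2) / (4 * of_real s))) +
      of_real (- (pi\<^sup>2 / 4) * t\<^sup>2) * (1 / (1 - \<i> * of_real (sqrt s * t))) =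
      log_gf (z s) - log_gf (complex_of_real s) + of_real (pi\<^sup>2 / (4 * s\<^sup>2)) * (z s - of_real s)"
      using eventually_at_right_less[of 0]
    proof eventually_elim
      case (elim s)
      define S where "S = complex_of_real s"
      define P where "P = complex_of_real (pi\<^sup>2) / 4"
      define y where "y = \<i> * complex_of_real (sqrt s * t)"
      have S: "S \<noteq> 0" using elim by (simp add: S_def)
      have y2: "y\<^sup>2 = - (S * of_real (t\<^sup>2))"
      proof -
        have "y\<^sup>2 = - of_real ((sqrt s)\<^sup>2 * t\<^sup>2)" by (simp add: y_def power_mult_distrib)
        then show ?thesis using elim by (simp add: S_def)
      qed
      have zS: "z s = S * (1 - y)" by (simp add: z_def S_def y_def complex_eq_iff)
      have "Re (1 - y) = 1" by (simp add: y_def)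
      then have y1: "1 - y \<noteq> 0" by auto
      have 1: "P * y\<^sup>2 / (S * (1 - y)) = P / (S * (1 - y)) - P / S * (1 + y)"
        using S y1 by (simp add: field_simps power2_eq_square)
      have 2: "P * y\<^sup>2 / (S * (1 - y)) = of_real (- (pi\<^sup>2 / 4) * t\<^sup>2) * (1 / (1 - y))"
        unfolding y2 using S by (simp add: P_def)
      have 3: "of_real (pi\<^sup>2) / (4 * (S * (1 - y))) = P / (S * (1 - y))"
        "of_real (pi\<^sup>2) / (4 * S) = P / S" by (simp_all add: P_def)
      have 4: "of_real (pi\<^sup>2 / (4 * s\<^sup>2)) * (S * (1 - y) - S) = - (P / S * y)"
        using S by (simp add: P_def S_def field_simps power2_eq_square)
      show ?case unfolding zS S_def[symmetric] y_def[symmetric] 2[symmetric] 3 4 1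
        by (simp add: distrib_left add_divide_distrib)
    qed
  qed
qed

section \<open>Coefficient extraction\<close>

text \<open>Orthogonality of characters in a scaled variable: the angle \<open>c * t\<close> covers
  one full period.\<close>

lemma integral_exp_period:
  fixes b c :: real and k n :: nat
  assumes "c > 0" "b = pi / c"
  shows "(\<integral>t. indicator {-b..b} t *\<^sub>R exp (\<i> * of_real ((real k - real n) * c * t)) \<partial>lborel) =
           (if k = n then of_real (2 * pi / c) else 0)"
proof (cases "k = n")
  case True
  have "b \<ge> 0" using assms by simp
  have "(\<integral>t. indicator {-b..b} t *\<^sub>R (1::complex) \<partial>lborel) = of_real b - of_real (- b)"
    using \<open>b \<ge> 0\<close> by (intro integral_FTC_Icc) (auto intro!: derivative_eq_intros)
  then show ?thesis using True assms by simp
next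
  case False
  define \<alpha> where "\<alpha> = (real k - real n) * c"
  have \<alpha>: "\<alpha> \<noteq> 0" using False assms by (simp add: \<alpha>_def)
  have "b \<ge> 0" using assms by simp
  define F where "F t = exp (\<i> * of_real (\<alpha> * t)) / (\<i> * of_real \<alpha>)" for t
  have "(\<integral>t. indicator {-b..b} t *\<^sub>R exp (\<i> * of_real (\<alpha> * t)) \<partial>lborel) = F b - F (- b)"
  proof (rule integral_FTC_Icc)
    show "(F has_vector_derivative exp (\<i> * of_real (\<alpha> * t))) (at t within {-b..b})" for t
      unfolding F_def using \<alpha>
      by (auto intro!: derivative_eq_intros has_vector_derivative_real_field simp: field_simps)
  qed (use \<open>b \<ge> 0\<close> in \<open>auto intro!: continuous_intros\<close>)
  also have "F b = F (- b)"
  proof -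
    have ab: "\<alpha> * b = (real k - real n) * pi" using assms by (simp add: \<alpha>_def)
    have "exp (\<i> * of_real (\<alpha> * b)) = exp (\<i> * of_real (\<alpha> * - b))"
    proof -
      have ab': "\<alpha> * - b = - ((real k - real n) * pi)" using ab by simp
      show ?thesis unfolding ab ab' exp_eq
        by (rule exI[of _ "int k - int n"]) (simp add: algebra_simps)
    qed
    then show ?thesis by (simp only: F_def)
  qed
  finally show ?thesis using False by (simp add: \<alpha>_def)
qed

lemma exp_Complex_power:
  "exp (- Complex s (- y)) ^ k = of_real (exp (- s) ^ k) * exp (\<i> * of_real (real k * y))"
proof -
  have "- Complex s (- y) = of_real (- s) + \<i> * of_real y" by (simp add: complex_eq_iff)
  then have "exp (- Complex s (- y)) ^ k = exp (of_nat k * (of_real (- s) + \<i> * of_real y))"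
    by (simp only: exp_of_nat_mult)
  also have "of_nat k * (of_real (- s) + \<i> * of_real y) = of_real (real k * - s) + \<i> * of_real (real k * y)"
    by (simp add: algebra_simps)
  also have "exp \<dots> = of_real (exp (real k * - s)) * exp (\<i> * of_real (real k * y))"
    by (simp only: exp_add exp_of_real)
  finally show ?thesis by (simp only: exp_of_nat_mult)
qed

text \<open>Cauchy's coefficient formula as a Fourier integral; the scale \<open>c\<close> is left
  free so that it can become the width of the saddle. Absolute summability at
  \<open>exp (- s)\<close> justifies termwise integration, and the series yields measurability
  without a study of the continuity of \<open>log_gf\<close>.\<close>

lemma overpartitions_fourier:
  fixes s c :: real
  assumes "s > 0" "c > 0"
  shows "(\<integral>t. indicator {- (pi / c)..pi / c} t *\<^sub>R
            (exp (log_gf (Complex s (- (c * t)))) * exp (- \<i> * of_real (real n * c * t))) \<partial>lborel)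
         = of_real (2 * pi / c * (real (overpartitions n) * exp (- s) ^ n))"
    and "(\<lambda>t. indicator {- (pi / c)..pi / c} t *\<^sub>R
            (exp (log_gf (Complex s (- (c * t)))) * exp (- \<i> * of_real (real n * c * t)))) \<in> borel_measurable lborel"
proof -
  define b where "b = pi / c"
  have b: "b \<ge> 0" using assms by (simp add: b_def)
  define A where "A k = real (overpartitions k) * exp (- s) ^ k" for k
  define f where "f k t = complex_of_real (A k) * (indicator {-b..b} t *\<^sub>R exp (\<i> * of_real ((real k - real n) * c * t)))" for k t
  have A0: "A k \<ge> 0" for k by (simp add: A_def)
  have sumA: "summable A" unfolding A_def by (rule summable_overpartitions[OF assms(1)])
  have nf: "norm (f k t) = A k * indicator {-b..b} t" for k t
    using A0[of k] by (simp add: f_def norm_mult)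
  have int0: "integrable lborel (\<lambda>t. indicator {-b..b} t *\<^sub>R exp (\<i> * of_real ((real k - real n) * c * t)))" for k
    by (rule borel_integrable_compact) (auto intro!: continuous_intros)
  have int: "integrable lborel (f k)" for k
    unfolding f_def by (intro integrable_mult_right int0)
  have sf: "summable (\<lambda>k. norm (f k t))" for t
    unfolding nf by (intro summable_mult2 sumA)
  have si: "summable (\<lambda>k. \<integral>t. norm (f k t) \<partial>lborel)"
    unfolding nf using b by (simp add: sumA summable_mult2)
  have suminf: "(\<Sum>k. f k t) = indicator {-b..b} t *\<^sub>R
      (exp (log_gf (Complex s (- (c * t)))) * exp (- \<i> * of_real (real n * c * t)))" for t
  proof -
    have "(\<lambda>k. of_nat (overpartitions k) * exp (- Complex s (- (c * t))) ^ k) sums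
        exp (log_gf (Complex s (- (c * t))))"
      using assms by (intro overpartitions_sums) simp
    from sums_mult[OF sums_mult2[OF this, of "exp (- \<i> * of_real (real n * c * t))"], of "of_real (indicator {-b..b} t)"]
    have "(\<lambda>k. of_real (indicator {-b..b} t) * (of_nat (overpartitions k) * exp (- Complex s (- (c * t))) ^ k
         * exp (- \<i> * of_real (real n * c * t)))) sums
       (of_real (indicator {-b..b} t) * (exp (log_gf (Complex s (- (c * t)))) * exp (- \<i> * of_real (real n * c * t))))" .
    moreover have "of_real (indicator {-b..b} t) * (of_nat (overpartitions k) * exp (- Complex s (- (c * t))) ^ k
         * exp (- \<i> * of_real (real n * c * t))) = f k t" for k
    proof -
      have "exp (\<i> * of_real ((real k - real n) * c * t)) =
          exp (\<i> * of_real (real k * (c * t))) * exp (- \<i> * of_real (real n * c * t))"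
        by (simp add: exp_add[symmetric] algebra_simps)
      then show ?thesis
        unfolding f_def A_def exp_Complex_power by (simp add: scaleR_conv_of_real)
    qed
    ultimately show ?thesis by (simp add: sums_iff scaleR_conv_of_real)
  qed
  have "(\<integral>t. (\<Sum>k. f k t) \<partial>lborel) = (\<Sum>k. \<integral>t. f k t \<partial>lborel)"
    by (rule integral_suminf[OF int _ si]) (use sf in auto)
  also have "(\<lambda>k. \<integral>t. f k t \<partial>lborel) = (\<lambda>k. if k = n then of_real (2 * pi / c * A n) else 0)"
  proof
    fix k
    have "(\<integral>t. f k t \<partial>lborel) = of_real (A k) * (if k = n then of_real (2 * pi / c) else 0)"
      unfolding f_def integral_mult_right_zero integral_exp_period[OF assms(2) b_def] ..
    then show "(\<integral>t. f k t \<partial>lborel) = (if k = n then of_real (2 * pi / c * A n) else 0)" by simp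
  qed
  also have "(\<Sum>k. if k = n then of_real (2 * pi / c * A n) else 0) = complex_of_real (2 * pi / c * A n)"
    using sums_single[of n "\<lambda>_. complex_of_real (2 * pi / c * A n)"] by (simp add: sums_iff)
  finally show "(\<integral>t. indicator {- (pi / c)..pi / c} t *\<^sub>R
            (exp (log_gf (Complex s (- (c * t)))) * exp (- \<i> * of_real (real n * c * t))) \<partial>lborel)
         = of_real (2 * pi / c * (real (overpartitions n) * exp (- s) ^ n))"
    unfolding suminf A_def b_def .
  have "(\<lambda>t. \<Sum>k. f k t) \<in> borel_measurable lborel"
    using int by (intro borel_measurable_suminf borel_measurable_integrable)
  then show "(\<lambda>t. indicator {- (pi / c)..pi / c} t *\<^sub>R
            (exp (log_gf (Complex s (- (c * t)))) * exp (- \<i> * of_real (real n * c * t)))) \<in> borel_measurable lborel"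
    unfolding suminf b_def .
qed

lemma gaussian_integral:
  "(\<integral>t. complex_of_real (exp (- (pi\<^sup>2 / 4) * t\<^sup>2)) \<partial>lborel) = of_real (2 / sqrt pi)"
proof -
  \<comment> \<open>The standard deviation solves
    \<open>1 / (2 * \<sigma>\<^sup>2) = pi\<^sup>2 / 4\<close>.\<close>
  have eq: "normal_density 0 (sqrt 2 / pi) t = sqrt pi / 2 * exp (- (pi\<^sup>2 / 4) * t\<^sup>2)" for t
  proof -
    have "2 * pi * (sqrt 2 / pi)\<^sup>2 = 4 / pi" by (simp add: power_divide power2_eq_square)
    then have "sqrt (2 * pi * (sqrt 2 / pi)\<^sup>2) = 2 / sqrt pi" by (simp add: real_sqrt_divide)
    moreover have "- (t - 0)\<^sup>2 / (2 * (sqrt 2 / pi)\<^sup>2) = - (pi\<^sup>2 / 4) * t\<^sup>2"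
      by (simp add: power_divide field_simps)
    ultimately show ?thesis unfolding normal_density_def by simp
  qed
  have "(\<integral>t. normal_density 0 (sqrt 2 / pi) t \<partial>lborel) = 1"
    by (rule integral_normal_density) simp
  then have "sqrt pi / 2 * (\<integral>t. exp (- (pi\<^sup>2 / 4) * t\<^sup>2) \<partial>lborel) = 1"
    by (simp only: eq integral_mult_right_zero)
  then have "(\<integral>t. exp (- (pi\<^sup>2 / 4) * t\<^sup>2) \<partial>lborel) = 2 / sqrt pi" by (simp add: field_simps)
  then show ?thesis by (simp only: integral_complex_of_real)
qed

lemma overpartitions_integral_tendsto:
  defines "s \<equiv> \<lambda>n. pi / (2 * sqrt (real n))"
  defines "c \<equiv> \<lambda>n. s n * sqrt (s n)"
  shows "(\<lambda>n. 2 * pi / c n * (real (overpartitions n) * exp (- s n) ^ n) * exp (- log_gf (s n)))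
           \<longlonglongrightarrow> 2 / sqrt pi"
proof -
  define \<Phi> where "\<Phi> n t = indicator {- (pi / c n)..pi / c n} t *\<^sub>R
      (exp (log_gf (Complex (s n) (- (c n * t)))) * exp (- \<i> * of_real (real n * c n * t)))
      * of_real (exp (- log_gf (s n)))" for n t
  have s_lim: "filterlim s (at_right 0) sequentially" unfolding s_def by real_asymp
  have s_pos: "s n > 0" "c n > 0" if "n \<ge> 1" for n using that by (auto simp: s_def c_def)
  have "eventually (\<lambda>n. n \<ge> 1 \<and> s n \<le> ln 2) sequentially"
  proof (rule eventually_conj[OF eventually_ge_at_top])
    have "eventually (\<lambda>x. x \<le> ln 2) (at_right (0::real))"
      unfolding eventually_at_right_field by (rule exI[of _ "ln 2"]) auto
    then show "eventually (\<lambda>n. s n \<le> ln 2) sequentially"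
      using s_lim by (rule eventually_compose_filterlim)
  qed
  \<comment> \<open>The majorant is available only for \<open>s n \<le> ln 2\<close>, while
    dominated convergence asks for it at every index; hence the shift by \<open>N\<close>.\<close>
  then obtain N where N: "\<And>n. n \<ge> N \<Longrightarrow> n \<ge> 1 \<and> s n \<le> ln 2"
    unfolding eventually_sequentially by blast
  have \<Phi>_int: "(\<integral>t. \<Phi> n t \<partial>lborel) =
      of_real (2 * pi / c n * (real (overpartitions n) * exp (- s n) ^ n) * exp (- log_gf (s n)))"
    if "n \<ge> 1" for n
    unfolding \<Phi>_def integral_mult_left_zero overpartitions_fourier(1)[OF s_pos[OF that]] by simp
  \<comment> \<open>At the saddle \<open>pi\<^sup>2 / (4 * (s n)\<^sup>2) = n\<close>, so the
    Fourier factor is exactly the linear term of \<open>log_gf_saddle_tendsto\<close>.\<close>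
  have \<Phi>_eq: "\<Phi> n t = indicator {- (pi / c n)..pi / c n} t *\<^sub>R
      exp (log_gf (Complex (s n) (- (s n * sqrt (s n) * t))) - log_gf (complex_of_real (s n))
        + of_real (pi\<^sup>2 / (4 * (s n)\<^sup>2)) * (Complex (s n) (- (s n * sqrt (s n) * t)) - of_real (s n)))"
    if "n \<ge> 1" for n t
  proof -
    have "pi\<^sup>2 / (4 * (s n)\<^sup>2) = real n" using that by (simp add: s_def power_divide power_mult_distrib)
    moreover have "Complex (s n) (- (c n * t)) - of_real (s n) = - \<i> * of_real (c n * t)"
      by (simp add: complex_eq_iff)
    ultimately have 1: "of_real (pi\<^sup>2 / (4 * (s n)\<^sup>2)) * (Complex (s n) (- (c n * t)) - of_real (s n)) =
        - \<i> * of_real (real n * c n * t)" by simp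
    have 2: "complex_of_real (exp (- log_gf (s n))) = exp (- log_gf (complex_of_real (s n)))"
      using s_pos[OF that] by (simp add: sums_log_gf_real(2) exp_of_real flip: of_real_minus)
    have 3: "exp (x - y + e) = exp x * exp e * exp (- y)" for x y e :: complex
    proof -
      have "x - y + e = x + e + - y" by simp
      then show ?thesis by (simp only: exp_add)
    qed
    have 4: "s n * sqrt (s n) = c n" by (simp add: c_def)
    show ?thesis unfolding \<Phi>_def 4 1 2 3 mult_scaleR_left ..
  qed
  have "(\<lambda>i. \<integral>t. \<Phi> (i + N) t \<partial>lborel) \<longlonglongrightarrow> (\<integral>t. complex_of_real (exp (- (pi\<^sup>2 / 4) * t\<^sup>2)) \<partial>lborel)"
  proof (rule integral_dominated_convergence[where w = "\<lambda>t. 1263168 * inverse (1 + t\<^sup>2)"])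
    show "\<Phi> (i + N) \<in> borel_measurable lborel" for i
      unfolding \<Phi>_def using N[of "i + N"]
      by (intro borel_measurable_times borel_measurable_const overpartitions_fourier(2) s_pos) auto
    have "integrable lborel (\<lambda>t::real. inverse (1 + t\<^sup>2))"
      using integrable_inverse_1_plus_square by (simp add: set_integrable_def)
    then show "integrable lborel (\<lambda>t::real. 1263168 * inverse (1 + t\<^sup>2))" by simp
    show "AE t in lborel. (\<lambda>i. \<Phi> (i + N) t) \<longlonglongrightarrow> complex_of_real (exp (- (pi\<^sup>2 / 4) * t\<^sup>2))"
    proof (rule AE_I2)
      fix t :: real
      define G where "G x = exp (log_gf (Complex x (- (x * sqrt x * t))) - log_gf (complex_of_real x)
        + of_real (pi\<^sup>2 / (4 * x\<^sup>2)) * (Complex x (- (x * sqrt x * t)) - of_real x))" for x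
      have "(G \<longlongrightarrow> exp (of_real (- (pi\<^sup>2 / 4) * t\<^sup>2))) (at_right 0)"
        unfolding G_def by (intro tendsto_exp log_gf_saddle_tendsto)
      then have "(\<lambda>n. G (s n)) \<longlonglongrightarrow> exp (of_real (- (pi\<^sup>2 / 4) * t\<^sup>2))"
        by (rule filterlim_compose[OF _ s_lim])
      moreover have "eventually (\<lambda>n. G (s n) = \<Phi> n t) sequentially"
      proof -
        have "filterlim (\<lambda>n. pi / c n) at_top sequentially"
          unfolding c_def s_def by real_asymp
        then have "eventually (\<lambda>n. pi / c n \<ge> \<bar>t\<bar>) sequentially"
          by (simp add: filterlim_at_top)
        then show ?thesis using eventually_ge_at_top[of 1]
        proof eventually_elim
          case (elim n)
          then have "t \<in> {- (pi / c n)..pi / c n}" by auto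
          then show ?case using \<Phi>_eq[of n t] elim by (simp add: G_def)
        qed
      qed
      ultimately have "(\<lambda>n. \<Phi> n t) \<longlonglongrightarrow> exp (of_real (- (pi\<^sup>2 / 4) * t\<^sup>2))"
        by (rule Lim_transform_eventually)
      then have "(\<lambda>n. \<Phi> n t) \<longlonglongrightarrow> complex_of_real (exp (- (pi\<^sup>2 / 4) * t\<^sup>2))"
        by (simp only: exp_of_real)
      then show "(\<lambda>i. \<Phi> (i + N) t) \<longlonglongrightarrow> complex_of_real (exp (- (pi\<^sup>2 / 4) * t\<^sup>2))"
        by (rule LIMSEQ_ignore_initial_segment)
    qed
    show "AE t in lborel. norm (\<Phi> (i + N) t) \<le> 1263168 * inverse (1 + t\<^sup>2)" for i
    proof (rule AE_I2)
      fix t :: real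
      define n where "n = i + N"
      have n: "n \<ge> 1" "s n \<le> ln 2" using N[of n] by (auto simp: n_def)
      have 1: "norm (exp (- \<i> * of_real x)) = 1" for x by simp
      have nz: "norm (\<Phi> n t) = indicator {- (pi / c n)..pi / c n} t *
          exp (Re (log_gf (Complex (s n) (- (s n * sqrt (s n) * t)))) - log_gf (s n))"
        unfolding \<Phi>_def norm_mult norm_scaleR 1 norm_exp_eq_Re norm_of_real
        by (simp add: exp_diff exp_minus inverse_eq_divide c_def)
      show "norm (\<Phi> (i + N) t) \<le> 1263168 * inverse (1 + t\<^sup>2)"
      proof (cases "t \<in> {- (pi / c n)..pi / c n}")
        case True
        then have "\<bar>t\<bar> \<le> pi / c n" by auto
        then have "c n * \<bar>t\<bar> \<le> pi" using s_pos[OF n(1)] by (simp add: field_simps)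
        then have "\<bar>s n * sqrt (s n) * t\<bar> \<le> pi"
          using s_pos[OF n(1)] by (simp add: c_def abs_mult)
        from log_gf_scaled_decay[OF s_pos(1)[OF n(1)] n(2) this]
        show ?thesis unfolding n_def[symmetric] nz using True by (simp add: divide_inverse)
      next
        case False
        then show ?thesis unfolding n_def[symmetric] nz by (simp add: add_nonneg_nonneg)
      qed
    qed
  qed simp
  then have "(\<lambda>i. complex_of_real (2 * pi / c (i + N) * (real (overpartitions (i + N)) * exp (- s (i + N)) ^ (i + N))
      * exp (- log_gf (s (i + N))))) \<longlonglongrightarrow> of_real (2 / sqrt pi)"
    unfolding gaussian_integral using N by (subst (asm) \<Phi>_int) auto
  then have "(\<lambda>i. 2 * pi / c (i + N) * (real (overpartitions (i + N)) * exp (- s (i + N)) ^ (i + N))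
      * exp (- log_gf (s (i + N)))) \<longlonglongrightarrow> 2 / sqrt pi"
    by (simp only: tendsto_of_real_iff)
  then show ?thesis by (rule LIMSEQ_offset)
qed

section \<open>The asymptotic formula\<close>

lemma exp_half_ln: "exp (ln x / 2) = sqrt x" if "x > 0" for x :: real
proof -
  have "ln x / 2 = ln (sqrt x)" using that by (simp add: ln_sqrt)
  then show ?thesis using that by simp
qed

theorem overpartitions_asymp_equiv:
  "(\<lambda>n. real (overpartitions n)) \<sim>[at_top] (\<lambda>n. 1 / (8 * real n) * exp (pi * sqrt (real n)))"
proof (rule asymp_equivI')
  define s where "s n = pi / (2 * sqrt (real n))" for n
  define c where "c n = s n * sqrt (s n)" for n
  define g where "g n = log_gf (s n) - pi\<^sup>2 / (4 * s n) - ln (s n) / 2" for n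
  have "filterlim s (at_right 0) sequentially" unfolding s_def by real_asymp
  then have "g \<longlonglongrightarrow> - ln 2 - ln pi / 2"
    unfolding g_def by (rule filterlim_compose[OF log_gf_expansion])
  \<comment> \<open>The factor \<open>exp (g n)\<close> trades \<open>exp (- log_gf (s n))\<close>
    for explicit functions. Its limit \<open>1 / (2 * sqrt pi)\<close> times
    \<open>2 / sqrt pi\<close> is \<open>1 / pi\<close>, hence the extra \<open>pi\<close>.\<close>
  then have "(\<lambda>n. (2 * pi / c n * (real (overpartitions n) * exp (- s n) ^ n) * exp (- log_gf (s n)))
      * exp (g n) * pi) \<longlonglongrightarrow> 2 / sqrt pi * exp (- ln 2 - ln pi / 2) * pi"
    unfolding c_def s_def by (intro tendsto_intros overpartitions_integral_tendsto)
  also have "2 / sqrt pi * exp (- ln 2 - ln pi / 2) * pi = 1"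
  proof -
    have "exp (- ln 2 - ln pi / 2) = 1 / 2 / sqrt pi"
      by (simp add: exp_diff exp_minus exp_half_ln)
    then show ?thesis by simp
  qed
  finally show "(\<lambda>n. real (overpartitions n) / (1 / (8 * real n) * exp (pi * sqrt (real n)))) \<longlonglongrightarrow> 1"
  proof (rule Lim_transform_eventually)
    show "\<forall>\<^sub>F n in sequentially. 2 * pi / c n * (real (overpartitions n) * exp (- s n) ^ n) * exp (- log_gf (s n)) * exp (g n) * pi =
        real (overpartitions n) / (1 / (8 * real n) * exp (pi * sqrt (real n)))"
      using eventually_ge_at_top[of 1]
    proof eventually_elim
      case (elim n)
      have s: "s n > 0" using elim by (simp add: s_def)
      have rn: "sqrt (real n) * sqrt (real n) = real n" by simp
      have e1: "exp (- s n) ^ n = exp (- (pi * sqrt (real n) / 2))"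
      proof -
        have "real n * s n = pi * sqrt (real n) / 2"
          using elim by (simp add: s_def field_simps)
        then show ?thesis by (simp add: exp_of_nat_mult[symmetric])
      qed
      have "pi\<^sup>2 / (4 * s n) = pi * sqrt (real n) / 2"
        using elim by (simp add: s_def field_simps power2_eq_square)
      then have "- log_gf (s n) + g n = - (pi * sqrt (real n) / 2) - ln (s n) / 2"
        by (simp add: g_def)
      then have e2: "exp (- log_gf (s n)) * exp (g n) = exp (- (pi * sqrt (real n) / 2)) / sqrt (s n)"
        unfolding exp_add[symmetric] by (simp only: exp_diff exp_half_ln[OF s])
      \<comment> \<open>This is where the 8 appears:
        \<open>2 * pi\<^sup>2 / (c n * sqrt (s n)) = 8 * n\<close>.\<close>
      have cs: "c n * sqrt (s n) = pi\<^sup>2 / (4 * real n)"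
      proof -
        have "c n * sqrt (s n) = s n * s n" using s by (simp add: c_def mult.assoc)
        then show ?thesis using elim by (simp add: s_def power2_eq_square)
      qed
      have e3: "exp (- (pi * sqrt (real n) / 2)) * exp (- (pi * sqrt (real n) / 2)) = 1 / exp (pi * sqrt (real n))"
      proof -
        have "exp (- x / 2) * exp (- x / 2) = 1 / exp x" for x :: real
          unfolding exp_add[symmetric] by (simp add: exp_minus inverse_eq_divide)
        from this[of "pi * sqrt (real n)"] show ?thesis by simp
      qed
      have "2 * pi / c n * (real (overpartitions n) * exp (- s n) ^ n) * exp (- log_gf (s n)) * exp (g n) * pi =
          2 * pi\<^sup>2 / (c n * sqrt (s n)) * real (overpartitions n)
            * (exp (- (pi * sqrt (real n) / 2)) * exp (- (pi * sqrt (real n) / 2)))"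
        unfolding e1 mult.assoc e2 by (simp add: power2_eq_square field_simps)
      also have "\<dots> = 8 * real n * real (overpartitions n) * (1 / exp (pi * sqrt (real n)))"
        unfolding cs e3 by simp
      finally show ?case by (simp add: field_simps)
    qed
  qed
qed

text \<open>The filter drives only the valuation to infinity, while \<open>p\<close>,
  \<open>n\<close> and \<open>D\<close> vary freely among the admissible triples. The estimate is
  uniform in them because the count is a function of the valuation, so the one-variable asymptotics
  is composed with it.\<close>

theorem theorem6p1:
  "(\<lambda>(p, n, D). real (num_genus_symbols p n D))
     \<sim>[inf (filtercomap (\<lambda>(p, n, D). multiplicity p D) at_top)
           (principal {(p :: int, n :: nat, D :: int).
              n > 0 \<and> D \<noteq> 0 \<and> prime p \<and> p \<noteq> 2 \<and> p dvd D \<and> multiplicity p D < n})]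
   (\<lambda>(p, n, D). 1 / (8 * real (multiplicity p D)) * exp (pi * sqrt (real (multiplicity p D))))"
  (is "_ \<sim>[inf (filtercomap ?m at_top) (principal ?A)] _")
proof -
  let ?F = "inf (filtercomap ?m at_top) (principal ?A)"
  have "filterlim ?m at_top ?F"
    by (rule filterlim_mono[OF filterlim_filtercomap order_refl inf_le1])
  from asymp_equiv_compose'[OF overpartitions_asymp_equiv this]
  have "(\<lambda>x. real (overpartitions (?m x))) \<sim>[?F]
      (\<lambda>x. 1 / (8 * real (?m x)) * exp (pi * sqrt (real (?m x))))" .
  moreover have "\<forall>\<^sub>F x in ?F. (case x of (p, n, D) \<Rightarrow> real (num_genus_symbols p n D)) = real (overpartitions (?m x))"
    unfolding eventually_inf_principal
    by (rule always_eventually) (auto simp: num_genus_symbols_eq_overpartitions)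
  ultimately have "(\<lambda>(p, n, D). real (num_genus_symbols p n D)) \<sim>[?F]
      (\<lambda>x. 1 / (8 * real (?m x)) * exp (pi * sqrt (real (?m x))))"
    by (subst asymp_equiv_cong[OF _ always_eventually]) auto
  then show ?thesis by (simp only: case_prod_unfold)
qed

end
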